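(* Let $q$ be a prime power, $n\ge1$, and $x_1,\dots,x_n$ positive reals with $x_1+\cdots+x_n=1$. For $S=\{i_1>i_2>\cdots>i_k\}\subseteq[n]$ let $\lambda_S(q,{\sf x})=\sum_{j=1}^k\frac{x_{i_j}}{q^{n-i_j-j+1}}$ and let $m(S)=d_{n-k}(q)\,q^{(n-i_1)+(n-1-i_2)+\cdots+(n-k+1-i_k)}$ if $k\ne n$, and $m([n])=1$. Then the characteristic polynomial of the transition matrix of the $q$-Tsetlin library $\mathcal{T}_{G/B}(q,{\sf x})$ on complete flags of $\mathbb{F}_q^n$ is $\prod_{S\subseteq[n]}(t-\lambda_S(q,{\sf x}))^{m(S)}$; i.e. its eigenvalues are the $\lambda_S(q,{\sf x})$ with (possibly zero) multiplicities $m(S)$. Moreover, $\mathcal{T}_{G/B}(q,{\sf x})$ is diagonalizable.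
   Context: Let $e_1,\dots,e_n$ be the standard basis of $\mathbb{F}_q^n$. A complete flag is $F=(V_0\subseteq\cdots\subseteq V_n)$ with $\dim V_i=i$. Each line is uniquely $L=\langle e_i+\sum_{k>i}c_ke_k\rangle$, with weight $y(L)=x_i/q^{n-i}$. The operator $\mathcal{T}_{G/B}(q,{\sf x})$ on the real vector space with basis the complete flags is $F\cdot\mathcal{T}_{G/B}(q,{\sf x})=\sum_{\text{lines }L}y(L)F_L$, where $F_L=(V_0\subseteq L\subseteq V_1+L\subseteq\cdots\subseteq V_{n-1}+L\subseteq V_n)$ with the repeated subspace removed. The $q$-derangement numbers are $d_m(q)=[m]_q!\sum_{k=0}^m\frac{(-1)^k}{[k]_q!}q^{\binom{k}{2}}$, with $[m]_q=1+q+\cdots+q^{m-1}$ and $[m]_q!=[1]_q\cdots[m]_q$. *)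

theory Defs
  imports "HOL-Analysis.Analysis" "Jordan_Normal_Form.Char_Poly"
begin

text \<open>
  The space \<open>\<bbbF>\<^sub>q\<^sup>n\<close> is \<open>'a ^ 'n\<close> with \<open>'a\<close> a finite field of size \<open>q\<close> and \<open>CARD('n) = n\<close>.
  The order of the standard basis is given by an enumeration \<open>b\<close>, a bijection from \<open>{1..n}\<close>
  onto the index type: the vector \<open>e\<^sub>i\<close> is \<open>std_basis b i\<close>.
\<close>

definition std_basis :: "(nat \<Rightarrow> 'n) \<Rightarrow> nat \<Rightarrow> 'a::field ^ 'n::finite" where
  "std_basis b i = axis (b i) 1"

definition lines :: "('a::field ^ 'n::finite) set set" where
  "lines = {L. vec.subspace L \<and> vec.dim L = 1}"

definition line_index :: "(nat \<Rightarrow> 'n) \<Rightarrow> ('a::field ^ 'n::finite) set \<Rightarrow> nat" where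
  "line_index b L = (THE i. i \<in> {1..CARD('n)} \<and>
     (\<exists>c. L = vec.span {std_basis b i + (\<Sum>k\<in>{i<..CARD('n)}. c k *s std_basis b k)}))"

definition line_weight ::
  "(nat \<Rightarrow> 'n) \<Rightarrow> (nat \<Rightarrow> real) \<Rightarrow> ('a::{field,finite} ^ 'n::finite) set \<Rightarrow> real" where
  "line_weight b x L =
     x (line_index b L) / real CARD('a) ^ (CARD('n) - line_index b L)"

text \<open>A flag is the list \<open>[V\<^sub>0, \<dots>, V\<^sub>n]\<close> of its members.\<close>

definition complete_flags :: "('a::field ^ 'n::finite) set list set" where
  "complete_flags = {F. length F = CARD('n) + 1
     \<and> (\<forall>i\<le>CARD('n). vec.subspace (F ! i) \<and> vec.dim (F ! i) = i)
     \<and> (\<forall>i<CARD('n). F ! i \<subseteq> F ! (i + 1))}"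

text \<open>The addition of subspaces below is the elementwise one of \<open>Set_Algebras\<close>.\<close>

definition flag_insert ::
  "('a::field ^ 'n::finite) set list \<Rightarrow> ('a ^ 'n) set \<Rightarrow> ('a ^ 'n) set list" where
  "flag_insert F L =
     remdups_adj (F ! 0 # L # map (\<lambda>i. F ! i + L) [1..<CARD('n)] @ [F ! CARD('n)])"

text \<open>The coefficient of the basis vector \<open>G\<close> in \<open>F \<cdot> \<T>\<close>.\<close>

definition tsetlin_coeff ::
  "(nat \<Rightarrow> 'n) \<Rightarrow> (nat \<Rightarrow> real) \<Rightarrow> ('a::{field,finite} ^ 'n::finite) set list
    \<Rightarrow> ('a ^ 'n) set list \<Rightarrow> real" where
  "tsetlin_coeff b x F G = (\<Sum>L\<in>{L \<in> lines. flag_insert F L = G}. line_weight b x L)"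

text \<open>The transition matrix with respect to an enumeration \<open>fs\<close> of the complete flags;
  rows are indexed by the current flag, since \<open>\<T>\<close> acts on the right.\<close>

definition tsetlin_matrix ::
  "(nat \<Rightarrow> 'n) \<Rightarrow> (nat \<Rightarrow> real) \<Rightarrow> ('a::{field,finite} ^ 'n::finite) set list list
    \<Rightarrow> real mat" where
  "tsetlin_matrix b x fs =
     mat (length fs) (length fs) (\<lambda>(i, j). tsetlin_coeff b x (fs ! i) (fs ! j))"

definition diagonalizable_mat :: "'a::field mat \<Rightarrow> bool" where
  "diagonalizable_mat A \<longleftrightarrow> (\<exists>D. diagonal_mat D \<and> similar_mat A D)"

definition q_number :: "real \<Rightarrow> nat \<Rightarrow> real" where
  "q_number q m = (\<Sum>i<m. q ^ i)"

definition q_fact :: "real \<Rightarrow> nat \<Rightarrow> real" where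
  "q_fact q m = (\<Prod>i=1..m. q_number q i)"

definition q_derangements :: "real \<Rightarrow> nat \<Rightarrow> real" where
  "q_derangements q m =
     q_fact q m * (\<Sum>k=0..m. (-1) ^ k / q_fact q k * q ^ (k choose 2))"

text \<open>The \<open>j\<close>-th largest element \<open>i\<^sub>j\<close> of \<open>S = {i\<^sub>1 > \<dots> > i\<^sub>k}\<close>, for \<open>1 \<le> j \<le> k\<close>.\<close>

definition desc_nth :: "nat set \<Rightarrow> nat \<Rightarrow> nat" where
  "desc_nth S j = rev (sorted_list_of_set S) ! (j - 1)"

text \<open>For \<open>S \<subseteq> {1..n}\<close> one has \<open>i\<^sub>j + j \<le> n + 1\<close>; the exponents \<open>n - i\<^sub>j - j + 1\<close> (in the
  eigenvalue) and \<open>n - j + 1 - i\<^sub>j\<close> (in the multiplicity) are both written \<open>n + 1 - i\<^sub>j - j\<close>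
  so that subtraction on \<open>nat\<close> does not truncate.\<close>

definition tsetlin_eigenvalue :: "real \<Rightarrow> nat \<Rightarrow> (nat \<Rightarrow> real) \<Rightarrow> nat set \<Rightarrow> real" where
  "tsetlin_eigenvalue q n x S =
     (\<Sum>j=1..card S. x (desc_nth S j) / q ^ (n + 1 - desc_nth S j - j))"

definition tsetlin_mult :: "real \<Rightarrow> nat \<Rightarrow> nat set \<Rightarrow> real" where
  "tsetlin_mult q n S =
     (if card S \<noteq> n
      then q_derangements q (n - card S) * q ^ (\<Sum>j=1..card S. n + 1 - desc_nth S j - j)
      else 1)"

end

theory Submission
  imports Defs "Jordan_Normal_Form.DL_Rank"
begin

text \<open>
  Replace the sum over lines by a sum over nonzero vectors and let words of vectors act on flags.
  A vector in the span \<open>U\<close> of a word is absorbed by the word, so for a test function \<open>h\<close> the operator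
  \<open>\<T>\<close> maps \<open>h(P \<cdot> F)\<close> to \<open>\<lambda>\<^sub>U h(P \<cdot> F)\<close> plus terms for longer words \<open>P v\<close> with strictly larger span,
  where \<open>\<lambda>\<^sub>U\<close> is the total weight of the lines in \<open>U\<close>. As the weights are positive, \<open>\<lambda>\<^sub>U\<close> is strictly
  increasing in \<open>U\<close>, hence the product of \<open>\<T> - r\<close> over the distinct values \<open>r\<close> of \<open>\<lambda>\<close> vanishes, and \<open>\<T>\<close>
  is diagonalizable.

  The number of flags fixed by a word with span \<open>U\<close> is \<open>[n - dim U]\<^sub>q!\<close>, which is the sum of
  \<open>d(n - dim Y)\<close> over the subspaces \<open>Y \<supseteq> U\<close>. Therefore the trace of a polynomial \<open>p(\<T>)\<close> is
  the sum of \<open>d(n - dim Y) p(\<lambda>\<^sub>Y)\<close> over all subspaces \<open>Y\<close>, which determines the multiplicities.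
  Grouping the subspaces by their set \<open>S\<close> of pivots, that is by Schubert cells, gives the formula:
  \<open>\<lambda>\<^sub>Y\<close> depends on \<open>S\<close> only, and the cell of \<open>S\<close> has \<open>q\<close>-power cardinality.
\<close>

section \<open>Diagonalizability from an annihilating product\<close>

context vec_space
begin

text \<open>Linearly independent subsets of \<open>E\<close> have at most \<open>dim\<close>
  elements, so a maximal one exists. Maximality puts all of \<open>E\<close> into its span, so it is
  a basis, and its vectors are the columns of an invertible matrix.\<close>

lemma spanning_set_contains_basis_list:
  assumes E: "E \<subseteq> carrier_vec n" and gen: "span E = carrier_vec n"
  obtains cs where "set cs \<subseteq> E" "length cs = n" "mat_of_cols n cs \<in> carrier_mat n n"
    "det (mat_of_cols n cs) \<noteq> 0"
proof -
  have bnd: "finite A \<and> card A \<le> dim" if "A \<subseteq> E \<and> lin_indpt A" for A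
    using li_le_dim[OF fin_dim] that E by auto
  have "\<exists>U. finite U \<and> maximal U (\<lambda>T. T \<subseteq> E \<and> lin_indpt T)"
    by (rule maximal_exists[of "\<lambda>T. T \<subseteq> E \<and> lin_indpt T" dim "{}"])
       (use bnd finite_lin_indpt2 in \<open>auto\<close>)
  then obtain U where fU: "finite U" and mU: "maximal U (\<lambda>T. T \<subseteq> E \<and> lin_indpt T)" by blast
  have UE: "U \<subseteq> E" and liU: "lin_indpt U" using mU by (auto simp: maximal_def)
  have UC: "U \<subseteq> carrier_vec n" using UE E by auto
  have "E \<subseteq> span U"
  proof
    fix e assume e: "e \<in> E"
    show "e \<in> span U"
    proof (rule ccontr)
      assume ne: "e \<notin> span U"
      then have "e \<notin> U" using UC span_mem by auto
      have "lin_indpt (U \<union> {e})"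
        using lin_dep_iff_in_span[of U e] UC liU ne e E \<open>e \<notin> U\<close> by auto
      then have "U = U \<union> {e}" using mU UE e unfolding maximal_def by blast
      with \<open>e \<notin> U\<close> show False by auto
    qed
  qed
  then have "carrier_vec n \<subseteq> span U" using gen UC by (metis span_is_subset span_is_submodule)
  then have "span U = carrier_vec n" using UC span_closed by auto
  then have "basis U" unfolding basis_def using liU UC by auto
  then have cU: "card U = n" using dim_basis[OF fU] dim_is_n by auto
  obtain cs where cs: "set cs = U" "distinct cs" using finite_distinct_list[OF fU] by blast
  then have len: "length cs = n" using cU distinct_card by metis
  have M: "mat_of_cols n cs \<in> carrier_mat n n" using len by auto
  have cc: "cols (mat_of_cols n cs) = cs" using cs UC by (intro cols_mat_of_cols) auto
  have "rank (mat_of_cols n cs) = n"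
    using lin_indpt_full_rank[OF M] cc cs liU by auto
  then have "det (mat_of_cols n cs) \<noteq> 0" using det_rank_iff[OF M] by auto
  then show thesis using that[OF _ len M] cs UE by auto
qed

end

lemma mat_mult_unit_vec:
  fixes M :: "'a::semiring_1 mat"
  assumes "M \<in> carrier_mat m n" "i < n"
  shows "M *\<^sub>v unit_vec n i = col M i"
  using assms by (intro eq_vecI) auto

text \<open>Take a basis of eigenvectors as the columns of \<open>P\<close>. Then
  \<open>M * P = P * D\<close> holds column by column, with the eigenvalues on the diagonal of
  \<open>D\<close>, and \<open>P\<close> is invertible.\<close>

lemma similar_diagonal_if_eigenvectors_span:
  fixes M :: "'a::field mat"
  assumes M: "M \<in> carrier_mat n n"
    and E: "E \<subseteq> carrier_vec n" and gen: "module.span class_ring (module_vec TYPE('a) n) E = carrier_vec n"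
    and ev: "\<And>e. e \<in> E \<Longrightarrow> \<exists>r. M *\<^sub>v e = r \<cdot>\<^sub>v e"
  obtains D where "D \<in> carrier_mat n n" "diagonal_mat D" "similar_mat M D"
proof -
  interpret vec_space "TYPE('a)" n .
  obtain cs where cs: "set cs \<subseteq> E" "length cs = n" and P: "mat_of_cols n cs \<in> carrier_mat n n"
    and det: "det (mat_of_cols n cs) \<noteq> 0"
    using spanning_set_contains_basis_list[OF E gen] by blast
  define P where "P = mat_of_cols n cs"
  obtain Q where Q: "Q \<in> carrier_mat n n" "P * Q = 1\<^sub>m n" "Q * P = 1\<^sub>m n"
    using det_non_zero_imp_unit[OF P det] P
    unfolding P_def Units_def ring_mat_def by auto
  have "\<forall>i<n. \<exists>r. M *\<^sub>v cs ! i = r \<cdot>\<^sub>v cs ! i" using ev cs by (metis nth_mem subsetD)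
  then obtain r where r: "\<And>i. i < n \<Longrightarrow> M *\<^sub>v cs ! i = r i \<cdot>\<^sub>v cs ! i" by metis
  define D where "D = mat n n (\<lambda>(i,j). if i = j then r i else 0)"
  have D: "D \<in> carrier_mat n n" "diagonal_mat D" by (auto simp: D_def diagonal_mat_def)
  have Pc: "P \<in> carrier_mat n n" using P P_def by simp
  have colP: "col P j = cs ! j" if "j < n" for j
    using that cs E unfolding P_def by (intro col_mat_of_cols) (auto dest!: nth_mem)
  have "M * P = P * D"
  proof (rule mat_col_eqI)
    fix j assume "j < dim_col (P * D)"
    then have j: "j < n" using D by auto
    have "col D j = r j \<cdot>\<^sub>v unit_vec n j"
      using j by (intro eq_vecI) (auto simp: D_def unit_vec_def)
    then have "col (P * D) j = r j \<cdot>\<^sub>v col P j"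
      using j Pc D by (simp add: col_mult2[OF Pc D(1) j] mult_mat_vec[OF Pc] mat_mult_unit_vec[OF Pc])
    moreover have "col (M * P) j = M *\<^sub>v cs ! j"
      using col_mult2[OF M Pc j] colP[OF j] by simp
    ultimately show "col (M * P) j = col (P * D) j" using r[OF j] colP[OF j] by simp
  qed (use M Pc D in auto)
  then have "M = P * D * Q"
    using M Pc Q D by (metis assoc_mult_mat right_mult_one_mat)
  then have "similar_mat M D"
    using M Pc Q D by (intro similar_matI[of M D P Q n]) auto
  with D show thesis using that by auto
qed

text \<open>The monic polynomial with root list \<open>rs\<close>, evaluated at \<open>M\<close>.
  The head of the list is the rightmost factor and hence the first one to act on a vector.\<close>

primrec shift_prod :: "'a::field mat \<Rightarrow> 'a list \<Rightarrow> 'a mat" where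
  "shift_prod M [] = 1\<^sub>m (dim_row M)"
| "shift_prod M (r # rs) = shift_prod M rs * (M - r \<cdot>\<^sub>m 1\<^sub>m (dim_row M))"

lemma shift_prod_carrier [simp]:
  "M \<in> carrier_mat n n \<Longrightarrow> shift_prod M rs \<in> carrier_mat n n"
  by (induction rs) auto

lemma shift_mult_vec:
  fixes M :: "'a::field mat"
  assumes "M \<in> carrier_mat n n" "v \<in> carrier_vec n"
  shows "(M - r \<cdot>\<^sub>m 1\<^sub>m n) *\<^sub>v v = M *\<^sub>v v - r \<cdot>\<^sub>v v"
  using assms by (subst minus_mult_distrib_mat_vec[of _ n n]) (auto intro!: eq_vecI)

lemma shift_prod_Cons_vec:
  fixes M :: "'a::field mat"
  assumes M: "M \<in> carrier_mat n n" and v: "v \<in> carrier_vec n"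
  shows "shift_prod M (r # rs) *\<^sub>v v = shift_prod M rs *\<^sub>v (M *\<^sub>v v - r \<cdot>\<^sub>v v)"
proof -
  have "M - r \<cdot>\<^sub>m 1\<^sub>m n \<in> carrier_mat n n" using M by auto
  then show ?thesis
    using assms by (simp add: assoc_mult_mat_vec[of _ n n _ n] shift_mult_vec)
qed

lemma shift_prod_eigenvector:
  fixes M :: "'a::field mat"
  assumes M: "M \<in> carrier_mat n n" and v: "v \<in> carrier_vec n" and ev: "M *\<^sub>v v = c \<cdot>\<^sub>v v"
  shows "shift_prod M rs *\<^sub>v v = (\<Prod>r\<leftarrow>rs. c - r) \<cdot>\<^sub>v v"
proof (induction rs)
  case Nil
  then show ?case using M v by auto
next
  case (Cons r rs)
  have "M *\<^sub>v v - r \<cdot>\<^sub>v v = (c - r) \<cdot>\<^sub>v v" using v ev by (intro eq_vecI) (auto simp: algebra_simps)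
  then show ?case
    using M v Cons by (subst shift_prod_Cons_vec)
      (auto simp: mult_mat_vec[of _ n n] smult_smult_assoc mult.commute simp del: shift_prod.simps)
qed

text \<open>One root is split off at a time. The vector \<open>u\<close>, the image of
  \<open>v\<close> under the factors in \<open>rs\<close>, is killed by the remaining factor, so it
  is an eigenvector for \<open>r\<close> or zero. As the roots are distinct, \<open>c\<close> is
  nonzero, and subtracting \<open>u\<close> divided by \<open>c\<close> from \<open>v\<close> leaves
  a vector killed by the factors in \<open>rs\<close> alone.\<close>

lemma shift_prod_kernel_in_span:
  fixes M :: "'a::field mat"
  assumes M: "M \<in> carrier_mat n n" and "distinct rs" and "v \<in> carrier_vec n"
    and "shift_prod M rs *\<^sub>v v = 0\<^sub>v n"
  shows "v \<in> module.span class_ring (module_vec TYPE('a) n) {e \<in> carrier_vec n. \<exists>r. M *\<^sub>v e = r \<cdot>\<^sub>v e}"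
  using assms(2-)
proof (induction rs arbitrary: v)
  case Nil
  interpret vec_space "TYPE('a)" n .
  from Nil have "v = 0\<^sub>v n" using M by auto
  moreover have "M *\<^sub>v 0\<^sub>v n = 0 \<cdot>\<^sub>v 0\<^sub>v n" using M by (intro eq_vecI) auto
  ultimately show ?case by (intro span_mem) auto
next
  case (Cons r rs)
  interpret vec_space "TYPE('a)" n .
  let ?E = "{e \<in> carrier_vec n. \<exists>r. M *\<^sub>v e = r \<cdot>\<^sub>v e}"
  note v = \<open>v \<in> carrier_vec n\<close>
  \<comment> \<open>The factor for \<open>r\<close> acts first. Commutation moves it to the front,
    where it acts on \<open>u\<close>.\<close>
  have comm: "shift_prod M rs * M = M * shift_prod M rs" for rs
  proof (induction rs)
    case (Cons s rs)
    let ?N = "M - s \<cdot>\<^sub>m 1\<^sub>m n"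
    have N: "?N \<in> carrier_mat n n" using M by auto
    have S: "shift_prod M rs \<in> carrier_mat n n" using M by simp
    have "?N * M = M * M - s \<cdot>\<^sub>m M"
      using M by (subst minus_mult_distrib_mat[of _ n n]) (auto simp: mult_smult_assoc_mat[of _ n n _ n])
    also have "\<dots> = M * ?N"
      using M by (subst mult_minus_distrib_mat[of _ n n]) (auto simp: mult_smult_distrib[of _ n n _ n])
    finally show ?case
      using assoc_mult_mat[OF S N M] assoc_mult_mat[OF S M N] assoc_mult_mat[OF M S N] M Cons by simp
  qed (use M in auto)
  define u where "u = shift_prod M rs *\<^sub>v v"
  define c where "c = (\<Prod>s\<leftarrow>rs. r - s)"
  have u: "u \<in> carrier_vec n" unfolding u_def by (rule mult_mat_vec_carrier[OF shift_prod_carrier[OF M] v])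
  have c: "c \<noteq> 0" unfolding c_def using Cons.prems(1) by auto
  note R = shift_prod_carrier[OF M, of rs]
  have "shift_prod M rs *\<^sub>v (M *\<^sub>v v) = M *\<^sub>v u"
    unfolding u_def using comm[of rs] by (metis assoc_mult_mat_vec shift_prod_carrier M v)
  then have "shift_prod M rs *\<^sub>v (M *\<^sub>v v - r \<cdot>\<^sub>v v) = M *\<^sub>v u - r \<cdot>\<^sub>v u"
    using mult_minus_distrib_mat_vec[OF R, of "M *\<^sub>v v" "r \<cdot>\<^sub>v v"] mult_mat_vec[OF R v, of r] M v
    by (simp only: u_def smult_carrier_vec mult_mat_vec_carrier)
  then have 0: "M *\<^sub>v u - r \<cdot>\<^sub>v u = 0\<^sub>v n"
    using Cons.prems shift_prod_Cons_vec[OF M v] by metis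
  have ev: "M *\<^sub>v u = r \<cdot>\<^sub>v u"
  proof (rule eq_vecI)
    fix i assume "i < dim_vec (r \<cdot>\<^sub>v u)"
    then have "(M *\<^sub>v u - r \<cdot>\<^sub>v u) $ i = 0" using 0 u by auto
    then show "(M *\<^sub>v u) $ i = (r \<cdot>\<^sub>v u) $ i" using \<open>i < _\<close> u by auto
  qed (use M u in auto)
  have "shift_prod M rs *\<^sub>v (v - (1 / c) \<cdot>\<^sub>v u) = u - (1 / c) \<cdot>\<^sub>v (c \<cdot>\<^sub>v u)"
    using mult_minus_distrib_mat_vec[OF R v, of "(1 / c) \<cdot>\<^sub>v u"]
      mult_mat_vec[OF R u, of "1 / c"] shift_prod_eigenvector[OF M u ev, of rs] u
    by (simp only: u_def[symmetric] c_def[symmetric] smult_carrier_vec)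
  also have "\<dots> = 0\<^sub>v n" using c u by (simp add: smult_smult_assoc)
  finally have "v - (1 / c) \<cdot>\<^sub>v u \<in> span ?E"
    using u v Cons.prems(1) by (intro Cons.IH) (simp_all only: distinct.simps minus_carrier_vec smult_carrier_vec)
  moreover have "(1 / c) \<cdot>\<^sub>v u \<in> span ?E"
  proof (rule span_mem)
    have "M *\<^sub>v ((1 / c) \<cdot>\<^sub>v u) = r \<cdot>\<^sub>v ((1 / c) \<cdot>\<^sub>v u)"
      unfolding mult_mat_vec[OF M u] ev by (simp add: smult_smult_assoc mult.commute)
    then show "(1 / c) \<cdot>\<^sub>v u \<in> ?E" using u by (intro CollectI conjI exI[of _ r]) simp_all
  qed simp
  ultimately have "(v - (1 / c) \<cdot>\<^sub>v u) + (1 / c) \<cdot>\<^sub>v u \<in> span ?E"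
    by (intro span_add1) simp_all
  moreover have "(v - (1 / c) \<cdot>\<^sub>v u) + (1 / c) \<cdot>\<^sub>v u = v"
    using u v by (intro eq_vecI) auto
  ultimately show ?case by simp
qed

lemma similar_diagonal_if_shift_prod_zero:
  fixes M :: "'a::field mat"
  assumes M: "M \<in> carrier_mat n n" and "distinct rs" and "shift_prod M rs = 0\<^sub>m n n"
  obtains D where "D \<in> carrier_mat n n" "diagonal_mat D" "similar_mat M D"
proof -
  interpret vec_space "TYPE('a)" n .
  let ?E = "{e \<in> carrier_vec n. \<exists>r. M *\<^sub>v e = r \<cdot>\<^sub>v e}"
  have "v \<in> span ?E" if "v \<in> carrier_vec n" for v
  proof (rule shift_prod_kernel_in_span[OF M assms(2) that])
    show "shift_prod M rs *\<^sub>v v = 0\<^sub>v n"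
      unfolding assms(3) using that by (intro eq_vecI) auto
  qed
  moreover have "span ?E \<subseteq> carrier_vec n"
    by (intro span_is_subset2) auto
  ultimately have "span ?E = carrier_vec n" by blast
  then show thesis
    using similar_diagonal_if_eigenvectors_span[OF M _ _, of ?E] that by blast
qed

section \<open>Traces of products of shifts\<close>

lemma sum_diag_mult_commute:
  fixes A B :: "'a::comm_semiring_0 mat"
  assumes "A \<in> carrier_mat n n" "B \<in> carrier_mat n n"
  shows "(\<Sum>i<n. (A * B) $$ (i, i)) = (\<Sum>i<n. (B * A) $$ (i, i))"
proof -
  have "(\<Sum>i<n. (A * B) $$ (i, i)) = (\<Sum>i<n. \<Sum>j<n. A $$ (i, j) * B $$ (j, i))"
    using assms by (auto simp: scalar_prod_def lessThan_atLeast0 intro!: sum.cong)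
  also have "\<dots> = (\<Sum>j<n. \<Sum>i<n. B $$ (j, i) * A $$ (i, j))"
    by (subst sum.swap) (auto simp: mult.commute)
  also have "\<dots> = (\<Sum>i<n. (B * A) $$ (i, i))"
    using assms by (auto simp: scalar_prod_def lessThan_atLeast0 intro!: sum.cong)
  finally show ?thesis .
qed

text \<open>Each factor is conjugated separately, and the inner pairs \<open>Q * P\<close>
  cancel.\<close>

lemma shift_prod_similar:
  fixes M D P Q :: "'a::field mat"
  assumes c: "M \<in> carrier_mat n n" "D \<in> carrier_mat n n" "P \<in> carrier_mat n n" "Q \<in> carrier_mat n n"
    and PQ: "P * Q = 1\<^sub>m n" and QP: "Q * P = 1\<^sub>m n" and M: "M = P * D * Q"
  shows "shift_prod M rs = P * shift_prod D rs * Q"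
proof (induction rs)
  case Nil
  then show ?case using c PQ by auto
next
  case (Cons r rs)
  let ?N = "D - r \<cdot>\<^sub>m 1\<^sub>m n"
  have N: "?N \<in> carrier_mat n n" and S: "shift_prod D rs \<in> carrier_mat n n" using c by auto
  have "P * ?N * Q = P * D * Q - r \<cdot>\<^sub>m 1\<^sub>m n"
    using c PQ
    by (subst mult_minus_distrib_mat[of _ n n], (auto)[3])
       (subst minus_mult_distrib_mat[of _ n n], auto simp: mult_smult_distrib[of P n n "1\<^sub>m n" n] mult_smult_assoc_mat[of P n n Q n])
  then have e: "M - r \<cdot>\<^sub>m 1\<^sub>m n = P * ?N * Q" using M by simp
  let ?S = "shift_prod D rs"
  have PS: "P * ?S \<in> carrier_mat n n" and QN: "?N * Q \<in> carrier_mat n n"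
    and PNQ: "P * (?N * Q) \<in> carrier_mat n n" using c N S by auto
  have "shift_prod M (r # rs) = (P * ?S * Q) * (P * ?N * Q)"
    using c e Cons by simp
  also have "\<dots> = P * ?S * (Q * (P * (?N * Q)))"
    using assoc_mult_mat[OF PS c(4) PNQ] assoc_mult_mat[OF c(3) N c(4)] by simp
  also have "Q * (P * (?N * Q)) = ?N * Q"
    using assoc_mult_mat[OF c(4,3) QN] QP QN by simp
  also have "P * ?S * (?N * Q) = P * (?S * ?N) * Q"
    using assoc_mult_mat[OF PS N c(4)] assoc_mult_mat[OF c(3) S N] by simp
  finally show ?case using c by simp
qed

lemma shift_prod_diagonal:
  fixes D :: "'a::field mat"
  assumes D: "D \<in> carrier_mat n n" "diagonal_mat D" and i: "i < n"
  shows "shift_prod D rs $$ (i, i) = (\<Prod>r\<leftarrow>rs. D $$ (i, i) - r)"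
proof -
  have "D *\<^sub>v unit_vec n i = D $$ (i, i) \<cdot>\<^sub>v unit_vec n i"
    using D i by (intro eq_vecI) (auto simp: diagonal_mat_def mat_mult_unit_vec[of _ n n])
  from shift_prod_eigenvector[OF D(1) _ this, of rs]
  have "col (shift_prod D rs) i = (\<Prod>r\<leftarrow>rs. D $$ (i, i) - r) \<cdot>\<^sub>v unit_vec n i"
    using D i by (simp add: mat_mult_unit_vec[of _ n n])
  from arg_cong[OF this, of "\<lambda>v. v $ i"] show ?thesis
    using D i shift_prod_carrier[OF D(1), of rs]  by (metis carrier_matD index_col index_smult_vec(1) index_unit_vec(1,3) mult.right_neutral)
qed

text \<open>The trace is invariant under conjugation, so it can be read off the diagonal form. Over
  all lists \<open>rs\<close> these traces determine the diagonal entries with multiplicity.\<close>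

lemma trace_shift_prod:
  fixes M :: "'a::field mat"
  assumes M: "M \<in> carrier_mat n n" and D: "D \<in> carrier_mat n n" "diagonal_mat D" and sim: "similar_mat M D"
  shows "(\<Sum>i<n. shift_prod M rs $$ (i, i)) = (\<Sum>i<n. \<Prod>r\<leftarrow>rs. D $$ (i, i) - r)"
proof -
  obtain P Q where w: "similar_mat_wit M D P Q" using sim unfolding similar_mat_def by blast
  note w' = similar_mat_witD2[OF M w]
  have "(\<Sum>i<n. shift_prod M rs $$ (i, i)) = (\<Sum>i<n. (P * (shift_prod D rs * Q)) $$ (i, i))"
    using shift_prod_similar[OF M D(1) w'(6,7,1,2,3), of rs] w' 
    by (simp add: assoc_mult_mat[of _ n n _ n _ n])
  also have "\<dots> = (\<Sum>i<n. (shift_prod D rs * Q * P) $$ (i, i))"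
    using w' by (intro sum_diag_mult_commute) (auto intro!: mult_carrier_mat[of _ n n])
  also have "shift_prod D rs * Q * P = shift_prod D rs"
    using w' right_mult_one_mat[OF shift_prod_carrier[OF D(1)]] by (simp add: assoc_mult_mat[of _ n n _ n _ n])
  finally show ?thesis using shift_prod_diagonal[OF D] by simp
qed

section \<open>The \<open>q\<close>-derangement numbers\<close>

lemma q_number_mult_diff: "q_number q m * (q - 1) = q ^ m - 1"
  by (induction m) (auto simp: q_number_def algebra_simps)

lemma q_number_add: "q_number q (a + b) = q_number q a + q ^ a * q_number q b"
  by (induction b) (auto simp: q_number_def algebra_simps power_add)

lemma q_number_Suc: "q_number q (Suc m) = q_number q m + q ^ m"
  by (simp add: q_number_def)

lemma q_number_pos: "0 < q \<Longrightarrow> 0 < m \<Longrightarrow> 0 < q_number q m"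
  unfolding q_number_def by (intro sum_pos) auto

lemma q_fact_0 [simp]: "q_fact q 0 = 1"
  by (simp add: q_fact_def)

lemma q_fact_Suc: "q_fact q (Suc m) = q_fact q m * q_number q (Suc m)"
  by (simp add: q_fact_def)

lemma q_fact_pos: "0 < q \<Longrightarrow> 0 < q_fact q m"
  unfolding q_fact_def by (intro prod_pos) (auto intro: q_number_pos)

lemma Suc_choose_2: "Suc m choose 2 = (m choose 2) + m"
  by (simp add: numeral_2_eq_2)

text \<open>With m = j + r + 1 and after multiplication by \<open>q_fact q m\<close>, this says that
  the alternating sum of \<open>q\<close>-binomials of m, cut off at j, is a single signed
  \<open>q\<close>-binomial of m - 1 over j times a power of \<open>q\<close>. Writing m as
  \<open>Suc (j + r)\<close> keeps the subtraction from truncating; the induction on j lowers r so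
  as to keep m fixed, hence r is arbitrary.\<close>

lemma alternating_q_sum_partial:
  fixes q :: real
  assumes q: "0 < q"
  shows "(\<Sum>k\<le>j. (-1) ^ k * q ^ (k choose 2) / (q_fact q k * q_fact q (Suc (j + r) - k)))
    = (-1) ^ j * q ^ (Suc j choose 2) / (q_fact q j * q_fact q r * q_number q (Suc (j + r)))"
proof (induction j arbitrary: r)
  case 0
  then show ?case by (simp add: q_fact_Suc Suc_choose_2 numeral_2_eq_2)
next
  case (Suc j)
  have pos: "q_fact q i \<noteq> 0" "q_number q (Suc i) \<noteq> 0" for i
    using q_fact_pos[OF q] q_number_pos[OF q, of "Suc i"] by (auto simp: less_le)
  \<comment> \<open>The \<open>q\<close>-Pascal rule in subtractive form: it merges the previous
    closed form with the new summand.\<close>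
  have diff: "q_number q (Suc j) - q_number q (Suc (Suc (j + r))) = - (q ^ Suc j * q_number q (Suc r))"
    using q_number_add[of q "Suc j" "Suc r"] by simp
  have "(\<Sum>k\<le>Suc j. (-1) ^ k * q ^ (k choose 2) / (q_fact q k * q_fact q (Suc (Suc j + r) - k)))
    = (-1) ^ j * q ^ (Suc j choose 2) / (q_fact q j * q_fact q (Suc r) * q_number q (Suc (Suc (j + r))))
      - (-1) ^ j * q ^ (Suc j choose 2) / (q_fact q (Suc j) * q_fact q (Suc r))"
    using Suc[of "Suc r"] by simp
  also have "\<dots> = (-1) ^ j * q ^ (Suc j choose 2) *
      (q_number q (Suc j) - q_number q (Suc (Suc (j + r))))
      / (q_fact q (Suc j) * q_fact q (Suc r) * q_number q (Suc (Suc (j + r))))"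
    using pos[of j] pos[of r] pos[of "Suc (j + r)"] by (simp add: q_fact_Suc divide_simps) (simp add: algebra_simps)
  also have "\<dots> = (-1) ^ Suc j * q ^ (Suc (Suc j) choose 2)
      / (q_fact q (Suc j) * q_fact q r * q_number q (Suc (Suc j + r)))"
    using pos[of j] pos[of r] pos(2)[of "Suc (j + r)"] unfolding diff
    by (simp add: q_fact_Suc[of _ r] power_add Suc_choose_2[of "Suc j"] divide_simps)
  finally show ?case .
qed

text \<open>Up to the factor \<open>q_fact q (Suc m)\<close> this is the \<open>q\<close>-binomial
  expansion of the product of 1 - q^i over i = 0, ..., m, whose factor for i = 0 is zero. Here the
  partial sum up to m cancels the last summand.\<close>

lemma alternating_q_sum_zero:
  fixes q :: real
  assumes q: "0 < q"
  shows "(\<Sum>k\<le>Suc m. (-1) ^ k * q ^ (k choose 2) / (q_fact q k * q_fact q (Suc m - k))) = 0"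
  using alternating_q_sum_partial[OF q, of m 0] by (simp add: q_fact_Suc)

text \<open>The \<open>q\<close>-analogue of the recurrence d(m+1) = (m+1) d(m) + (-1)^(m+1) of the
  derangement numbers.\<close>

lemma q_derangements_Suc:
  assumes q: "0 < q"
  shows "q_derangements q (Suc m)
    = q_number q (Suc m) * q_derangements q m + (-1) ^ Suc m * q ^ (Suc m choose 2)"
  using q_fact_pos[OF q, of m] q_number_pos[OF q, of "Suc m"]
  by (simp add: q_derangements_def q_fact_Suc atLeast0AtMost algebra_simps)

text \<open>The \<open>q\<close>-analogue of counting permutations by their fixed points. After
  division by \<open>q_fact q m\<close> the left side is a convolution of the partial sums
  \<open>C\<close> with the inverse factorials. Passing from m to m + 1 changes it by the
  alternating sum that vanishes, so it stays at 1.\<close>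

lemma sum_q_derangements:
  fixes q :: real
  assumes q: "0 < q"
  shows "(\<Sum>j\<le>m. q_fact q m / (q_fact q j * q_fact q (m - j)) * q_derangements q (m - j)) = q_fact q m"
proof -
  define c where "c k = (-1) ^ k / q_fact q k * q ^ (k choose 2)" for k
  define C where "C i = (\<Sum>k\<le>i. c k)" for i
  have pos: "q_fact q i \<noteq> 0" for i
    using q_fact_pos[OF q] by (auto simp: less_le)
  have "(\<Sum>i\<le>m. C i / q_fact q (m - i)) = 1" for m
  proof (induction m)
    case 0
    then show ?case by (simp add: C_def c_def numeral_2_eq_2)
  next
    case (Suc m)
    have "(\<Sum>i\<le>Suc m. C i / q_fact q (Suc m - i))
      = c 0 / q_fact q (Suc m) + (\<Sum>i\<le>m. C (Suc i) / q_fact q (m - i))"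
      by (subst sum.atMost_Suc_shift) (simp add: C_def)
    also have "\<dots> = (\<Sum>i\<le>m. C i / q_fact q (m - i))
        + (c 0 / q_fact q (Suc m) + (\<Sum>i\<le>m. c (Suc i) / q_fact q (m - i)))"
      by (simp add: C_def add_divide_distrib sum.distrib)
    also have "c 0 / q_fact q (Suc m) + (\<Sum>i\<le>m. c (Suc i) / q_fact q (m - i))
      = (\<Sum>k\<le>Suc m. c k / q_fact q (Suc m - k))"
      by (subst sum.atMost_Suc_shift) simp
    also have "\<dots> = 0"
      using alternating_q_sum_zero[OF q, of m] by (simp add: c_def)
    finally show ?case using Suc by simp
  qed
  then have 1: "(\<Sum>j\<le>m. C (m - j) / q_fact q j) = 1"
    by (subst sum.nat_diff_reindex[symmetric, of _ "Suc m", simplified lessThan_Suc_atMost]) simp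
  have "(\<Sum>j\<le>m. q_fact q m / (q_fact q j * q_fact q (m - j)) * q_derangements q (m - j))
    = q_fact q m * (\<Sum>j\<le>m. C (m - j) / q_fact q j)"
    unfolding sum_distrib_left
    using pos by (intro sum.cong refl) (auto simp: q_derangements_def C_def c_def atLeast0AtMost)
  then show ?thesis using 1 by simp
qed

text \<open>Multiplicities are exponents of polynomials and must be natural numbers. The closed
  formula has alternating signs; this two-step recurrence has none.\<close>

fun q_derangement_number :: "nat \<Rightarrow> nat \<Rightarrow> nat" where
  "q_derangement_number q 0 = 1"
| "q_derangement_number q (Suc 0) = 0"
| "q_derangement_number q (Suc (Suc m)) = (\<Sum>i<Suc m. q ^ i) *
     (q_derangement_number q (Suc m) + q ^ Suc m * q_derangement_number q m)"

text \<open>The signed term of the one-step recurrence for m + 2 is expressed by the same recurrence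
  for m + 1, which yields the two-step recurrence of \<open>q_derangement_number\<close>.\<close>

lemma q_derangements_eq_nat:
  assumes "0 < q"
  shows "q_derangements (real q) m = real (q_derangement_number q m)"
proof -
  have q: "0 < real q" using assms by simp
  show ?thesis
  proof (induction m rule: induct_nat_012)
    case (ge2 m)
    let ?D = "q_derangements (real q)"
    have "?D (Suc (Suc m)) = q_number (real q) (Suc (Suc m)) * ?D (Suc m)
        - real q ^ Suc m * ((-1) ^ Suc m * real q ^ (Suc m choose 2))"
      unfolding q_derangements_Suc[OF q, of "Suc m"] Suc_choose_2[of "Suc m"] by (simp add: power_add)
    also have "(-1) ^ Suc m * real q ^ (Suc m choose 2) = ?D (Suc m) - q_number (real q) (Suc m) * ?D m"
      unfolding q_derangements_Suc[OF q, of m] by simp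
    finally have "?D (Suc (Suc m)) = q_number (real q) (Suc m) * (?D (Suc m) + real q ^ Suc m * ?D m)"
      by (simp add: q_number_Suc[of _ "Suc m"] algebra_simps)
    then show ?case using ge2 by (simp add: q_number_def)
  qed (auto simp: q_derangements_def q_fact_def q_number_def numeral_2_eq_2)
qed

section \<open>Subspaces of a finite vector space\<close>

lemma card_eq_card_times_fiber:
  assumes "finite A" and "f ` A \<subseteq> B" and "finite B" and "\<And>y. y \<in> B \<Longrightarrow> card {a \<in> A. f a = y} = c"
  shows "card A = card B * c"
proof -
  have "card A = card (\<Union>y\<in>B. {a \<in> A. f a = y})"
    using assms(2) by (intro arg_cong[of _ _ card]) auto
  also have "\<dots> = (\<Sum>y\<in>B. card {a \<in> A. f a = y})"
    using assms by (intro card_UN_disjoint) auto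
  finally show ?thesis using assms by simp
qed

lemma field_card_ge_2: "2 \<le> CARD('a::{field,finite})"
  using card_mono[of UNIV "{0::'a, 1}"] by simp

text \<open>Every element of the span is \<open>c *s v + s\<close> for exactly one scalar
  \<open>c\<close> and one \<open>s\<close> in \<open>S\<close>.\<close>

lemma card_span_insert:
  fixes S :: "('a::{field,finite} ^ 'n::finite) set"
  assumes S: "vec.subspace S" and v: "v \<notin> S"
  shows "card (vec.span (insert v S)) = CARD('a) * card S"
proof -
  let ?f = "\<lambda>(c, s). c *s v + s"
  have "vec.span (insert v S) = ?f ` (UNIV \<times> S)"
  proof (intro subset_antisym subsetI)
    fix x assume "x \<in> vec.span (insert v S)"
    then obtain k where "x - k *s v \<in> vec.span S"
      using vec.span_breakdown_eq[of x v S] by blast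
    then have "x - k *s v \<in> S" using S vec.span_eq_iff by metis
    then show "x \<in> ?f ` (UNIV \<times> S)" by (intro image_eqI[of _ _ "(k, x - k *s v)"]) auto
  next
    fix x assume "x \<in> ?f ` (UNIV \<times> S)"
    then obtain c s where "x = c *s v + s" "s \<in> S" by auto
    then show "x \<in> vec.span (insert v S)"
      by (auto intro: vec.span_add vec.span_scale vec.span_base)
  qed
  moreover have "inj_on ?f (UNIV \<times> S)"
  proof (rule inj_onI, clarify)
    fix c d s t assume st: "s \<in> S" "t \<in> S" and e: "c *s v + s = d *s v + t"
    have "(c - d) *s v = t - s" using e by (simp add: vec.scale_left_diff_distrib algebra_simps)
    then have "(c - d) *s v \<in> S" using vec.subspace_diff[OF S st(2,1)] by simp
    have "c = d"
    proof (rule ccontr)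
      assume "c \<noteq> d"
      then have "v = inverse (c - d) *s ((c - d) *s v)" by (simp only: vec.scale_scale) simp
      then show False using vec.subspace_scale[OF S \<open>(c - d) *s v \<in> S\<close>, of "inverse (c - d)"] v by simp
    qed
    then show "c = d \<and> s = t" using e by simp
  qed
  ultimately show ?thesis by (simp add: card_image card_cartesian_product)
qed

lemma card_subspace:
  fixes S :: "('a::{field,finite} ^ 'n::finite) set"
  assumes "vec.subspace S"
  shows "card S = CARD('a) ^ vec.dim S"
proof -
  obtain B where B: "B \<subseteq> S" "vec.independent B" "S \<subseteq> vec.span B" "card B = vec.dim S"
    using vec.basis_exists by blast
  have "card (vec.span B) = CARD('a) ^ card B" if "finite B" "vec.independent B" for B :: "('a ^ 'n) set"
    using that
  proof (induction B)
    case (insert v B)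
    have v: "v \<notin> vec.span B" and iB: "vec.independent B"
      using insert.prems insert.hyps vec.independent_insert[of v B] by auto
    have "vec.span (insert v B) = vec.span (insert v (vec.span B))"
      using vec.span_mono[of B "insert v B"]
      by (subst vec.span_eq) (auto intro: vec.span_base)
    then show ?case using card_span_insert[OF vec.subspace_span v] insert iB by simp
  qed simp
  moreover have "vec.span B = S" using B assms by (intro subset_antisym vec.span_minimal)
  ultimately show ?thesis using B by (metis finite)
qed

lemma dim_eq_if_card_eq:
  fixes S :: "('a::{field,finite} ^ 'n::finite) set"
  assumes "vec.subspace S" "card S = CARD('a) ^ k"
  shows "vec.dim S = k"
  using assms field_card_ge_2[where 'a='a] power_inject_exp[of "CARD('a)"] card_subspace[OF assms(1)] by simp

lemma dim_span_insert:
  fixes S :: "('a::field ^ 'n::finite) set"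
  assumes "vec.subspace S" "v \<notin> S"
  shows "vec.dim (vec.span (insert v S)) = vec.dim S + 1"
  using assms by (simp add: vec.dim_insert vec.span_eq_iff[THEN iffD2])

lemma span_insert_eq_cover:
  fixes X Z :: "('a::field ^ 'n::finite) set"
  assumes "vec.subspace X" "vec.subspace Z" "X \<subseteq> Z" "vec.dim Z = vec.dim X + 1" "v \<in> Z" "v \<notin> X"
  shows "vec.span (insert v X) = Z"
proof (rule vec.subspace_dim_equal)
  show "vec.span (insert v X) \<subseteq> Z" using assms by (intro vec.span_minimal) auto
qed (use assms dim_span_insert[of X v] in simp_all)

text \<open>The upper covers of \<open>X\<close> inside \<open>Y\<close> in the lattice of
  subspaces, that is, the lines of the quotient of \<open>Y\<close> by \<open>X\<close>.\<close>

definition covers :: "('a::field ^ 'n::finite) set \<Rightarrow> ('a ^ 'n) set \<Rightarrow> ('a ^ 'n) set set" where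
  "covers X Y = {Z. vec.subspace Z \<and> X \<subseteq> Z \<and> Z \<subseteq> Y \<and> vec.dim Z = vec.dim X + 1}"

text \<open>The vectors of \<open>Y - X\<close> are counted by the cover that they generate together
  with \<open>X\<close>. A cover \<open>Z\<close> arises from exactly the vectors of
  \<open>Z - X\<close>, whose number is the same for all \<open>Z\<close>.\<close>

lemma card_covers:
  fixes X Y :: "('a::{field,finite} ^ 'n::finite) set"
  assumes X: "vec.subspace X" and Y: "vec.subspace Y" and XY: "X \<subseteq> Y"
  shows "real (card (covers X Y)) = q_number (real CARD('a)) (vec.dim Y - vec.dim X)"
proof -
  let ?q = "real CARD('a)"
  have "card {v \<in> Y - X. vec.span (insert v X) = Z} = CARD('a) ^ (vec.dim X + 1) - CARD('a) ^ vec.dim X"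
    if Z: "Z \<in> covers X Y" for Z
  proof -
    have "{v \<in> Y - X. vec.span (insert v X) = Z} = Z - X"
    proof (intro subset_antisym subsetI)
      fix v assume "v \<in> {v \<in> Y - X. vec.span (insert v X) = Z}"
      then show "v \<in> Z - X" using vec.span_base[of v "insert v X"] by auto
    next
      fix v assume "v \<in> Z - X"
      then show "v \<in> {v \<in> Y - X. vec.span (insert v X) = Z}"
        using Z span_insert_eq_cover[OF X, of Z v] by (auto simp: covers_def)
    qed
    then show ?thesis
      using Z X card_subspace[of Z] card_subspace[of X] by (simp add: covers_def card_Diff_subset)
  qed
  moreover have "(\<lambda>v. vec.span (insert v X)) ` (Y - X) \<subseteq> covers X Y"
  proof (intro image_subsetI)
    fix v assume v: "v \<in> Y - X"
    have "vec.span (insert v X) \<subseteq> Y" using v XY by (intro vec.span_minimal[OF _ Y]) auto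
    moreover have "X \<subseteq> vec.span (insert v X)" using vec.span_superset[of "insert v X"] by auto
    ultimately show "vec.span (insert v X) \<in> covers X Y"
      using dim_span_insert[OF X, of v] v by (simp add: covers_def)
  qed
  ultimately have "card (Y - X) = card (covers X Y) * (CARD('a) ^ (vec.dim X + 1) - CARD('a) ^ vec.dim X)"
    by (intro card_eq_card_times_fiber) auto
  moreover have "card (Y - X) = CARD('a) ^ vec.dim Y - CARD('a) ^ vec.dim X"
    using XY card_subspace[OF X] card_subspace[OF Y] by (simp add: card_Diff_subset)
  ultimately have "real (CARD('a) ^ vec.dim Y - CARD('a) ^ vec.dim X)
     = real (card (covers X Y)) * real (CARD('a) ^ (vec.dim X + 1) - CARD('a) ^ vec.dim X)"
    by (metis of_nat_mult)
  moreover have d: "vec.dim X \<le> vec.dim Y" using XY by (rule vec.dim_subset)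
  ultimately have "?q ^ vec.dim Y - ?q ^ vec.dim X = real (card (covers X Y)) * (?q ^ vec.dim X * (?q - 1))"
    using field_card_ge_2[where 'a='a] by (simp add: of_nat_diff power_increasing algebra_simps)
  moreover have "?q ^ vec.dim Y - ?q ^ vec.dim X
      = q_number ?q (vec.dim Y - vec.dim X) * (?q ^ vec.dim X * (?q - 1))"
  proof -
    obtain k where k: "vec.dim Y = vec.dim X + k" using d le_Suc_ex by blast
    then have "?q ^ vec.dim Y - ?q ^ vec.dim X = ?q ^ vec.dim X * (?q ^ k - 1)"
      by (simp add: power_add right_diff_distrib)
    then show ?thesis using k by (simp add: q_number_mult_diff mult.left_commute[of "q_number _ _"])
  qed
  ultimately have "real (card (covers X Y)) * (?q ^ vec.dim X * (?q - 1))
      = q_number ?q (vec.dim Y - vec.dim X) * (?q ^ vec.dim X * (?q - 1))" by metis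
  moreover have "?q ^ vec.dim X * (?q - 1) \<noteq> 0" using field_card_ge_2[where 'a='a] by simp
  ultimately show ?thesis by (metis mult_right_cancel)
qed

text \<open>The right side is a \<open>q\<close>-binomial coefficient. Induction on \<open>j\<close>
  counts pairs of a cover \<open>Z\<close> of \<open>X\<close> and a space \<open>Y\<close> above
  \<open>Z\<close> in two ways: by \<open>Z\<close> with the hypothesis for \<open>j\<close>, and by
  \<open>Y\<close> with \<open>card_covers\<close>.\<close>

lemma card_superspaces:
  fixes X :: "('a::{field,finite} ^ 'n::finite) set"
  assumes "vec.subspace X" and "vec.dim X + j \<le> CARD('n)"
  shows "real (card {Y. vec.subspace Y \<and> X \<subseteq> Y \<and> vec.dim Y = vec.dim X + j})
    = q_fact (real CARD('a)) (CARD('n) - vec.dim X)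
      / (q_fact (real CARD('a)) j * q_fact (real CARD('a)) (CARD('n) - vec.dim X - j))"
  using assms
proof (induction j arbitrary: X)
  case 0
  have "{Y. vec.subspace Y \<and> X \<subseteq> Y \<and> vec.dim Y = vec.dim X + 0} = {X}"
  proof (intro subset_antisym subsetI)
    fix Y assume "Y \<in> {Y. vec.subspace Y \<and> X \<subseteq> Y \<and> vec.dim Y = vec.dim X + 0}"
    then have "X = Y" using 0(1) by (intro vec.subspace_dim_equal) simp_all
    then show "Y \<in> {X}" by simp
  qed (use 0 in auto)
  moreover have "q_fact (real CARD('a)) (CARD('n) - vec.dim X) \<noteq> 0"
    using q_fact_pos[of "real CARD('a)" "CARD('n) - vec.dim X"] by (simp only: less_le) simp
  ultimately show ?case by simp
next
  case (Suc j)
  let ?q = "real CARD('a)" and ?m = "CARD('n) - vec.dim X"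
  let ?S = "\<lambda>X j. {Y. vec.subspace Y \<and> X \<subseteq> Y \<and> vec.dim Y = vec.dim X + j}"
  have pos: "q_fact ?q i \<noteq> 0" "q_number ?q (Suc i) \<noteq> 0" for i
    using q_fact_pos[of ?q i] q_number_pos[of ?q "Suc i"] by auto
  obtain m where m: "?m = Suc m" using Suc.prems by (cases ?m) auto
  have "(\<Sum>Z\<in>covers X UNIV. \<Sum>Y | Y \<in> ?S X (Suc j) \<and> Z \<subseteq> Y. 1)
      = (\<Sum>Y\<in>?S X (Suc j). \<Sum>Z | Z \<in> covers X UNIV \<and> Z \<subseteq> Y. 1::real)"
    by (rule sum.swap_restrict) auto
  also have "\<dots> = (\<Sum>Y\<in>?S X (Suc j). real (card (covers X Y)))"
    by (intro sum.cong refl) (auto intro!: arg_cong[of _ _ card] simp: covers_def)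
  also have "\<dots> = real (card (?S X (Suc j))) * q_number ?q (Suc j)"
    using card_covers[OF Suc.prems(1)] by simp
  also have "(\<Sum>Z\<in>covers X UNIV. \<Sum>Y | Y \<in> ?S X (Suc j) \<and> Z \<subseteq> Y. 1::real)
      = (\<Sum>Z\<in>covers X UNIV. q_fact ?q m / (q_fact ?q j * q_fact ?q (m - j)))"
  proof (intro sum.cong refl)
    fix Z assume Z: "Z \<in> covers X UNIV"
    have "{Y. Y \<in> ?S X (Suc j) \<and> Z \<subseteq> Y} = ?S Z j" using Z by (auto simp: covers_def)
    moreover have "CARD('n) - vec.dim Z = m" using Z m by (simp add: covers_def)
    ultimately show "(\<Sum>Y | Y \<in> ?S X (Suc j) \<and> Z \<subseteq> Y. 1::real) = q_fact ?q m / (q_fact ?q j * q_fact ?q (m - j))"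
      using Suc.IH[of Z] Z Suc.prems by (simp add: covers_def)
  qed
  also have "\<dots> = q_number ?q (Suc m) * (q_fact ?q m / (q_fact ?q j * q_fact ?q (m - j)))"
    using card_covers[OF Suc.prems(1) vec.subspace_UNIV] m by (simp add: vec_dim_card del: vec.dim_UNIV)
  finally show ?case using m pos by (simp add: q_fact_Suc field_simps)
qed

text \<open>Grouping by the dimension over \<open>X\<close> reduces this to
  \<open>sum_q_derangements\<close>. It turns the number of flags fixed by a word into a sum over
  subspaces, which is where the \<open>q\<close>-derangement numbers enter the trace.\<close>

lemma sum_q_derangements_superspaces:
  fixes X :: "('a::{field,finite} ^ 'n::finite) set"
  assumes X: "vec.subspace X"
  shows "(\<Sum>Y | vec.subspace Y \<and> X \<subseteq> Y. q_derangements (real CARD('a)) (CARD('n) - vec.dim Y))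
    = q_fact (real CARD('a)) (CARD('n) - vec.dim X)"
proof -
  let ?q = "real CARD('a)" and ?m = "CARD('n) - vec.dim X"
  let ?D = "\<lambda>Y::('a ^ 'n) set. q_derangements ?q (CARD('n) - vec.dim Y)"
  have le: "vec.dim Y \<le> CARD('n)" for Y :: "('a ^ 'n) set" by (rule dim_subset_UNIV_cart_gen)
  have "(\<Sum>Y | vec.subspace Y \<and> X \<subseteq> Y. ?D Y)
    = (\<Sum>j\<le>?m. \<Sum>Y | Y \<in> {Y. vec.subspace Y \<and> X \<subseteq> Y} \<and> vec.dim Y - vec.dim X = j. ?D Y)"
    by (rule sum.group[symmetric]) (auto simp: le diff_le_mono)
  also have "\<dots> = (\<Sum>j\<le>?m. q_fact ?q ?m / (q_fact ?q j * q_fact ?q (?m - j)) * q_derangements ?q (?m - j))"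
  proof (intro sum.cong refl)
    fix j assume j: "j \<in> {..?m}"
    have "{Y. Y \<in> {Y. vec.subspace Y \<and> X \<subseteq> Y} \<and> vec.dim Y - vec.dim X = j}
      = {Y. vec.subspace Y \<and> X \<subseteq> Y \<and> vec.dim Y = vec.dim X + j}"
    proof (intro Collect_cong)
      fix Y
      show "Y \<in> {Y. vec.subspace Y \<and> X \<subseteq> Y} \<and> vec.dim Y - vec.dim X = j \<longleftrightarrow>
        vec.subspace Y \<and> X \<subseteq> Y \<and> vec.dim Y = vec.dim X + j"
        using vec.dim_subset[of X Y] by auto
    qed
    then show "(\<Sum>Y | Y \<in> {Y. vec.subspace Y \<and> X \<subseteq> Y} \<and> vec.dim Y - vec.dim X = j. ?D Y)
      = q_fact ?q ?m / (q_fact ?q j * q_fact ?q (?m - j)) * q_derangements ?q (?m - j)"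
      using card_superspaces[OF X, of j] j le[of X] by simp
  qed
  also have "\<dots> = q_fact ?q ?m" by (rule sum_q_derangements) simp
  finally show ?thesis .
qed

section \<open>Schubert cells\<close>

text \<open>A new minimum comes last in the descending enumeration and leaves the other positions
  alone. Pivot sets are therefore built up from the largest element downwards.\<close>

lemma desc_nth_insert_smaller:
  assumes "finite S" and "\<And>s. s \<in> S \<Longrightarrow> i < s"
  shows "1 \<le> j \<Longrightarrow> j \<le> card S \<Longrightarrow> desc_nth (insert i S) j = desc_nth S j"
    and "desc_nth (insert i S) (Suc (card S)) = i"
proof -
  have "i \<notin> S" using assms(2)[of i] by auto
  then have "sorted_list_of_set (insert i S) = i # sorted_list_of_set S"
    using assms by (simp add: insort_is_Cons less_imp_le)
  then show "1 \<le> j \<Longrightarrow> j \<le> card S \<Longrightarrow> desc_nth (insert i S) j = desc_nth S j"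
    and "desc_nth (insert i S) (Suc (card S)) = i"
    by (auto simp: desc_nth_def nth_append)
qed

lemma card_insert_smaller:
  fixes S :: "nat set"
  assumes "finite S" and "\<And>s. s \<in> S \<Longrightarrow> i < s"
  shows "card (insert i S) = Suc (card S)"
proof -
  have "i \<notin> S" using assms(2)[of i] by auto
  then show ?thesis using assms(1) by simp
qed

section \<open>Leading positions and pivot sets\<close>

locale ordered_basis =
  fixes b :: "nat \<Rightarrow> 'n::finite"
  assumes bij_b: "bij_betw b {1..CARD('n)} UNIV"
begin

text \<open>For nonzero \<open>v\<close> this is the index of the line through \<open>v\<close>, see
  \<open>line_index_span\<close>. At 0 the value is unspecified.\<close>

definition lead :: "'a::field ^ 'n \<Rightarrow> nat" where
  "lead v = (LEAST i. i \<in> {1..CARD('n)} \<and> vec_nth v (b i) \<noteq> 0)"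

text \<open>The span of the basis vectors after position \<open>i\<close>. These spaces form the
  standard flag to which the Schubert cells refer.\<close>

definition tail_space :: "nat \<Rightarrow> ('a::field ^ 'n) set" where
  "tail_space i = {v. \<forall>j\<in>{1..i}. vec_nth v (b j) = 0}"

text \<open>The pivot columns of a reduced echelon basis of \<open>Y\<close>, described without
  choosing such a basis.\<close>

definition pivots :: "('a::field ^ 'n) set \<Rightarrow> nat set" where
  "pivots Y = lead ` (Y - {0})"

lemma lead_props:
  fixes v :: "'a::field ^ 'n"
  assumes "v \<noteq> 0"
  shows "lead v \<in> {1..CARD('n)}" and "vec_nth v (b (lead v)) \<noteq> 0"
proof -
  obtain k where k: "vec_nth v k \<noteq> 0" using assms by (auto simp: Finite_Cartesian_Product.vec_eq_iff)
  have "k \<in> b ` {1..CARD('n)}" using bij_betw_imp_surj_on[OF bij_b] by simp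
  then obtain i where "i \<in> {1..CARD('n)}" "b i = k" by blast
  then have "i \<in> {1..CARD('n)} \<and> vec_nth v (b i) \<noteq> 0" using k by simp
  then have "lead v \<in> {1..CARD('n)} \<and> vec_nth v (b (lead v)) \<noteq> 0"
    unfolding lead_def by (rule LeastI)
  then show "lead v \<in> {1..CARD('n)}" "vec_nth v (b (lead v)) \<noteq> 0" by auto
qed

lemma lead_le:
  "i \<in> {1..CARD('n)} \<Longrightarrow> vec_nth v (b i) \<noteq> 0 \<Longrightarrow> lead v \<le> i"
  unfolding lead_def by (rule Least_le) simp

lemma lead_eqI:
  assumes "i \<in> {1..CARD('n)}" "vec_nth v (b i) \<noteq> 0" "\<And>j. j \<in> {1..<i} \<Longrightarrow> vec_nth v (b j) = 0"
  shows "lead v = i"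
  unfolding lead_def using assms by (intro Least_equality) (auto intro: leI)

lemma lead_scale: "c \<noteq> 0 \<Longrightarrow> lead (c *s v) = lead v"
  by (simp add: lead_def)

lemma subspace_tail_space: "vec.subspace (tail_space i)"
  by (auto simp: tail_space_def vec.subspace_def)

lemma mem_tail_space_iff:
  fixes v :: "'a::field ^ 'n"
  assumes "v \<noteq> 0" "i \<le> CARD('n)"
  shows "v \<in> tail_space i \<longleftrightarrow> i < lead v"
proof
  assume "v \<in> tail_space i"
  then show "i < lead v"
    using lead_props[OF assms(1)] by (intro ccontr[of "i < lead v"]) (auto simp: tail_space_def)
next
  assume "i < lead v"
  then show "v \<in> tail_space i"
    unfolding tail_space_def using lead_le[of _ v] assms(2) by fastforce
qed

lemma card_tail_space:
  assumes "i \<le> CARD('n)"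
  shows "card (tail_space i :: ('a::{field,finite} ^ 'n) set) = CARD('a) ^ (CARD('n) - i)"
proof -
  have inj: "inj_on b {1..CARD('n)}" and surj: "b ` {1..CARD('n)} = UNIV"
    using bij_b by (auto simp: bij_betw_def)
  let ?d = "b ` {i<..CARD('n)}"
  have "tail_space i = {v :: 'a ^ 'n. \<forall>k. k \<notin> ?d \<longrightarrow> vec_nth v k = 0}"
  proof (intro subset_antisym subsetI)
    fix v :: "'a ^ 'n" assume v: "v \<in> tail_space i"
    have "vec_nth v k = 0" if "k \<notin> ?d" for k
    proof -
      have "k \<in> b ` {1..CARD('n)}" using surj by simp
      then obtain j where "j \<in> {1..CARD('n)}" "k = b j" by blast
      then have "j \<in> {1..i}" using that by auto
      then show ?thesis using v \<open>k = b j\<close> by (auto simp: tail_space_def)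
    qed
    then show "v \<in> {v. \<forall>k. k \<notin> ?d \<longrightarrow> vec_nth v k = 0}" by blast
  next
    fix v :: "'a ^ 'n" assume v: "v \<in> {v. \<forall>k. k \<notin> ?d \<longrightarrow> vec_nth v k = 0}"
    have "b j \<notin> ?d" if "j \<in> {1..i}" for j
    proof
      assume "b j \<in> ?d"
      then obtain l where l: "l \<in> {i<..CARD('n)}" "b j = b l" by blast
      have "j = l" by (rule inj_onD[OF inj l(2)]) (use l(1) that assms in auto)
      then show False using l(1) that by simp
    qed
    then show "v \<in> tail_space i" using v by (auto simp: tail_space_def)
  qed
  then have "vec.dim (tail_space i :: ('a ^ 'n) set) = card ?d"
    using dim_substandard_cart[of ?d, where 'a='a] by simp
  also have "\<dots> = CARD('n) - i"
    by (subst card_image[OF inj_on_subset[OF inj]]) auto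
  finally show ?thesis using card_subspace[OF subspace_tail_space] by metis
qed

text \<open>These vectors form the difference of two consecutive tail spaces.\<close>

lemma card_lead_eq:
  assumes i: "i \<in> {1..CARD('n)}"
  shows "card {v :: 'a::{field,finite} ^ 'n. v \<noteq> 0 \<and> lead v = i}
    = CARD('a) ^ (CARD('n) - i) * (CARD('a) - 1)"
proof -
  have "{v :: 'a ^ 'n. v \<noteq> 0 \<and> lead v = i} = tail_space (i - 1) - tail_space i"
  proof (intro subset_antisym subsetI)
    fix v :: "'a ^ 'n" assume "v \<in> tail_space (i - 1) - tail_space i"
    moreover from this have "v \<noteq> 0" using vec.subspace_0[OF subspace_tail_space] by auto
    ultimately show "v \<in> {v. v \<noteq> 0 \<and> lead v = i}"
      using mem_tail_space_iff[of v i] mem_tail_space_iff[of v "i - 1"] i by fastforce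
  next
    fix v :: "'a ^ 'n" assume "v \<in> {v. v \<noteq> 0 \<and> lead v = i}"
    then show "v \<in> tail_space (i - 1) - tail_space i"
      using mem_tail_space_iff[of v i] mem_tail_space_iff[of v "i - 1"] i by auto
  qed
  moreover have "tail_space i \<subseteq> (tail_space (i - 1) :: ('a ^ 'n) set)" by (auto simp: tail_space_def)
  moreover have "CARD('n) - (i - 1) = Suc (CARD('n) - i)" using i by auto
  ultimately show ?thesis
    using i card_tail_space[of i, where 'a='a] card_tail_space[of "i - 1", where 'a='a]
    by (simp add: card_Diff_subset algebra_simps)
qed

text \<open>Gaussian elimination at the smallest pivot \<open>i\<close>: intersection with the tail
  space removes this pivot, and any vector of \<open>Y\<close> led by \<open>i\<close> restores
  \<open>Y\<close>.\<close>

lemma pivots_insert_smaller: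
  fixes Y :: "('a::field ^ 'n) set"
  assumes Y: "vec.subspace Y" and piv: "pivots Y = insert i S"
    and less: "\<And>s. s \<in> S \<Longrightarrow> i < s" and i: "i \<in> {1..CARD('n)}"
  shows "pivots (Y \<inter> tail_space i) = S" and "{v \<in> Y. v \<noteq> 0 \<and> lead v = i} = Y - tail_space i"
    and "v \<in> Y \<Longrightarrow> v \<noteq> 0 \<Longrightarrow> lead v = i \<Longrightarrow> vec.span (insert v (Y \<inter> tail_space i)) = Y"
proof -
  have lead_ge: "lead y = i \<or> lead y \<in> S" if "y \<in> Y" "y \<noteq> 0" for y
    using that piv unfolding pivots_def by blast
  have tail: "y \<in> tail_space i \<longleftrightarrow> i < lead y" if "y \<noteq> 0" for y :: "'a ^ 'n"
    using mem_tail_space_iff[OF that] i by simp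
  show "pivots (Y \<inter> tail_space i) = S"
  proof (intro subset_antisym subsetI)
    fix s assume "s \<in> pivots (Y \<inter> tail_space i)"
    then obtain y where "y \<in> Y" "y \<in> tail_space i" "y \<noteq> 0" "s = lead y" by (auto simp: pivots_def)
    then show "s \<in> S" using lead_ge tail by blast
  next
    fix s assume s: "s \<in> S"
    then have "s \<in> lead ` (Y - {0})" using piv by (simp add: pivots_def)
    then obtain y where "y \<in> Y" "y \<noteq> 0" "s = lead y" by auto
    then show "s \<in> pivots (Y \<inter> tail_space i)" using tail[of y] less[OF s] by (auto simp: pivots_def)
  qed
  show "{v \<in> Y. v \<noteq> 0 \<and> lead v = i} = Y - tail_space i"
    using lead_ge tail less vec.subspace_0[OF subspace_tail_space[of i]]
    by (auto) (metis less_irrefl)+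
  show "vec.span (insert v (Y \<inter> tail_space i)) = Y" if v: "v \<in> Y" "v \<noteq> 0" "lead v = i"
  proof (intro subset_antisym subsetI)
    fix y assume "y \<in> vec.span (insert v (Y \<inter> tail_space i))"
    then show "y \<in> Y" using vec.span_minimal[of "insert v (Y \<inter> tail_space i)" Y] Y v by auto
  next
    fix y assume y: "y \<in> Y"
    \<comment> \<open>This multiple of \<open>v\<close> clears coordinate \<open>b i\<close> of
      \<open>y\<close>; the earlier coordinates vanish in both vectors because no lead in
      \<open>Y\<close> lies below \<open>i\<close>.\<close>
    let ?c = "vec_nth y (b i) / vec_nth v (b i)"
    have "y - ?c *s v \<in> Y" using Y v y by (intro vec.subspace_diff vec.subspace_scale)
    moreover have "y - ?c *s v \<in> tail_space i"
      unfolding tail_space_def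
    proof (clarify)
      fix j assume j: "j \<in> {1..i}"
      have vi: "vec_nth v (b i) \<noteq> 0" using lead_props[OF v(2)] v(3) by simp
      show "vec_nth (y - ?c *s v) (b j) = 0"
      proof (cases "j = i")
        case False
        then have ji: "j < i" "j \<in> {1..CARD('n)}" using j i by auto
        have "vec_nth v (b j) = 0" using lead_le[OF ji(2), of v] v ji by auto
        moreover have "vec_nth y (b j) = 0"
        proof (cases "y = 0")
          case False
          then have "i \<le> lead y" using lead_ge[OF y] less by (auto intro: less_imp_le)
          then show ?thesis using lead_le[OF ji(2), of y] ji by auto
        qed simp
        ultimately show ?thesis by simp
      qed (use vi in simp)
    qed
    ultimately have "y - ?c *s v \<in> vec.span (Y \<inter> tail_space i)" by (auto intro: vec.span_base)
    then show "y \<in> vec.span (insert v (Y \<inter> tail_space i))"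
      using vec.span_breakdown_eq by blast
  qed
qed

text \<open>The converse of the elimination step. As \<open>Y\<close> lies in the tail space of
  \<open>i\<close>, every sum of a nonzero multiple of \<open>v\<close> and an element of
  \<open>Y\<close> is led by \<open>i\<close>, so only the elements of \<open>Y\<close> stay in the
  tail space.\<close>

lemma pivots_span_insert:
  fixes Y :: "('a::field ^ 'n) set"
  assumes Y: "vec.subspace Y" and piv: "pivots Y = S" and v: "v \<noteq> 0" "lead v = i"
    and less: "\<And>s. s \<in> S \<Longrightarrow> i < s"
  shows "pivots (vec.span (insert v Y)) = insert i S" and "vec.span (insert v Y) \<inter> tail_space i = Y"
proof -
  have i: "i \<in> {1..CARD('n)}" using lead_props[OF v(1)] v(2) by simp
  have Yt: "Y \<subseteq> tail_space i"
  proof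
    fix y assume y: "y \<in> Y"
    show "y \<in> tail_space i"
    proof (cases "y = 0")
      case False
      then have "lead y \<in> S" using y piv by (auto simp: pivots_def)
      then show ?thesis using less mem_tail_space_iff[OF False] i by auto
    qed (use vec.subspace_0[OF subspace_tail_space] in simp)
  qed
  have vt: "v \<notin> tail_space i" using mem_tail_space_iff[OF v(1), of i] i v(2) by simp
  have span: "\<exists>c y. z = c *s v + y \<and> y \<in> Y" if z: "z \<in> vec.span (insert v Y)" for z
  proof -
    obtain c where "z - c *s v \<in> vec.span Y" using z vec.span_breakdown_eq[of z v Y] by blast
    then have "z - c *s v \<in> Y" using Y vec.span_eq_iff by metis
    then show ?thesis by (intro exI[of _ c] exI[of _ "z - c *s v"]) simp
  qed
  have lead: "c *s v + y \<notin> tail_space i \<and> lead (c *s v + y) = i" if "c \<noteq> 0" "y \<in> Y" for c y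
  proof -
    have "vec_nth y (b j) = 0" if "j \<in> {1..i}" for j
      using that \<open>y \<in> Y\<close> Yt by (auto simp: tail_space_def)
    moreover have "vec_nth v (b j) = 0" if "j \<in> {1..<i}" for j
      using lead_le[of j v] that i v(2) by fastforce
    moreover have "vec_nth v (b i) \<noteq> 0" using lead_props[OF v(1)] v(2) by simp
    ultimately have "lead (c *s v + y) = i" and "vec_nth (c *s v + y) (b i) \<noteq> 0"
      using i \<open>c \<noteq> 0\<close> by (auto intro!: lead_eqI)
    then show ?thesis using i by (auto simp: tail_space_def)
  qed
  have sup: "Y \<subseteq> vec.span (insert v Y)" "v \<in> vec.span (insert v Y)"
    using vec.span_superset[of "insert v Y"] by auto
  show "pivots (vec.span (insert v Y)) = insert i S"
  proof (intro subset_antisym subsetI)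
    fix s assume "s \<in> pivots (vec.span (insert v Y))"
    then obtain z where z: "z \<in> vec.span (insert v Y)" "z \<noteq> 0" "s = lead z" by (auto simp: pivots_def)
    obtain c y where cy: "z = c *s v + y" "y \<in> Y" using span[OF z(1)] by blast
    show "s \<in> insert i S"
    proof (cases "c = 0")
      case True
      then have "z \<in> Y - {0}" using cy z by simp
      then show ?thesis using z piv by (auto simp: pivots_def)
    next
      case False
      then show ?thesis using lead[OF False cy(2)] z(3) cy(1) by simp
    qed
  next
    fix s assume "s \<in> insert i S"
    then show "s \<in> pivots (vec.span (insert v Y))"
      using piv sup v unfolding pivots_def by auto
  qed
  show "vec.span (insert v Y) \<inter> tail_space i = Y"
  proof (intro subset_antisym subsetI)
    fix z assume z: "z \<in> vec.span (insert v Y) \<inter> tail_space i"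
    then obtain c y where cy: "z = c *s v + y" "y \<in> Y" using span by blast
    then have "c = 0" using lead[of c y] z by auto
    then show "z \<in> Y" using cy by simp
  qed (use sup Yt in auto)
qed

lemma pivots_empty_iff: "vec.subspace Y \<Longrightarrow> pivots Y = {} \<longleftrightarrow> Y = {0}"
  using vec.subspace_0[of Y] by (auto simp: pivots_def)

lemma pivots_subset: "pivots Y \<subseteq> {1..CARD('n)}"
  unfolding pivots_def using lead_props(1) by blast

text \<open>Removing the smallest pivot divides the size by \<open>q\<close>. In particular the
  dimension is the number of pivots.\<close>

lemma card_if_pivots:
  fixes Y :: "('a::{field,finite} ^ 'n) set"
  assumes "vec.subspace Y" "pivots Y = S" "finite S" "S \<subseteq> {1..CARD('n)}"
  shows "card Y = CARD('a) ^ card S"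
  using assms(3,1,2,4)
proof (induction S arbitrary: Y rule: finite_linorder_min_induct)
  case empty
  then show ?case by (simp add: pivots_empty_iff)
next
  case (insert i S)
  have i: "i \<in> {1..CARD('n)}" using insert by auto
  note P = pivots_insert_smaller[OF insert.prems(1,2) _ i]
  have "i \<in> lead ` (Y - {0})" using insert.prems(2) by (simp add: pivots_def)
  then obtain v where v: "v \<in> Y" "v \<noteq> 0" "lead v = i" by blast
  have sub: "vec.subspace (Y \<inter> tail_space i)"
    using insert.prems(1) subspace_tail_space by (rule vec.subspace_inter)
  have "v \<notin> Y \<inter> tail_space i" using mem_tail_space_iff[OF v(2), of i] v i by auto
  from card_span_insert[OF sub this] P(3)[OF _ v] insert.hyps
  have "card Y = CARD('a) * card (Y \<inter> tail_space i)" by simp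
  also have "\<dots> = CARD('a) * CARD('a) ^ card S"
    using insert.IH[OF sub] P(1) insert by simp
  finally show ?case using card_insert_smaller[of S i] insert.hyps by simp
qed

section \<open>Cells of subspaces with given pivots\<close>

definition pivot_cell :: "nat set \<Rightarrow> ('a::field ^ 'n) set set" where
  "pivot_cell S = {Y. vec.subspace Y \<and> pivots Y = S}"

text \<open>The dimension of the Schubert cell \<open>pivot_cell S\<close>; it is the exponent of
  \<open>q\<close> in \<open>tsetlin_mult\<close>.\<close>

definition cell_dim :: "nat set \<Rightarrow> nat" where
  "cell_dim S = (\<Sum>j=1..card S. CARD('n) + 1 - desc_nth S j - j)"

lemma sum_desc_nth_insert_smaller:
  fixes f :: "nat \<Rightarrow> nat \<Rightarrow> 'c::comm_monoid_add"
  assumes "finite S" and "\<And>s. s \<in> S \<Longrightarrow> i < s"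
  shows "(\<Sum>j=1..card (insert i S). f (desc_nth (insert i S) j) j)
    = (\<Sum>j=1..card S. f (desc_nth S j) j) + f i (Suc (card S))"
  using desc_nth_insert_smaller[OF assms] card_insert_smaller[OF assms] by simp

text \<open>Pairs of a vector led by the new minimum \<open>i\<close> and a space in the cell of
  \<open>S\<close> are counted by their span. There are q^(n-i) (q-1) vectors to choose from and
  every span arises q^k (q-1) times, where k is the size of \<open>S\<close>, so the cell grows by
  the factor q^(n-i-k).\<close>

lemma card_pivot_cell:
  assumes "finite S" "S \<subseteq> {1..CARD('n)}"
  shows "card (pivot_cell S :: ('a::{field,finite} ^ 'n) set set) = CARD('a) ^ cell_dim S"
  using assms
proof (induction S rule: finite_linorder_min_induct)
  case empty
  have "pivot_cell {} = {{0} :: ('a ^ 'n) set}"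
    using pivots_empty_iff by (fastforce simp: pivot_cell_def)
  then show ?case by (simp add: cell_dim_def)
next
  case (insert i S)
  let ?q = "CARD('a)" and ?k = "card S"
  have less: "\<And>s. s \<in> S \<Longrightarrow> i < s" using insert.hyps by blast
  have i: "i \<in> {1..CARD('n)}" using insert by auto
  have q: "?q - 1 \<noteq> 0" using field_card_ge_2[where 'a='a] by simp
  let ?A = "{v :: 'a ^ 'n. v \<noteq> 0 \<and> lead v = i} \<times> (pivot_cell S :: ('a ^ 'n) set set)"
  let ?f = "\<lambda>(v, Y). vec.span (insert v Y)"
  \<comment> \<open>The span \<open>Y\<close> determines the second component as its intersection
    with the tail space; the vector may be any element of \<open>Y\<close> led by
    \<open>i\<close>.\<close>
  have fiber: "card {p \<in> ?A. ?f p = Y} = ?q ^ ?k * (?q - 1)" if Y: "Y \<in> pivot_cell (insert i S)" for Y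
  proof -
    have Ys: "vec.subspace Y" and piv: "pivots Y = insert i S" using Y by (auto simp: pivot_cell_def)
    note P = pivots_insert_smaller[OF Ys piv less i]
    have sub: "vec.subspace (Y \<inter> tail_space i)"
      using Ys subspace_tail_space by (rule vec.subspace_inter)
    have "{p \<in> ?A. ?f p = Y} = {v \<in> Y. v \<noteq> 0 \<and> lead v = i} \<times> {Y \<inter> tail_space i}"
    proof (intro subset_antisym subsetI)
      fix p assume "p \<in> {p \<in> ?A. ?f p = Y}"
      then obtain v Z where p: "p = (v, Z)" "v \<noteq> 0" "lead v = i" "Z \<in> pivot_cell S" "vec.span (insert v Z) = Y"
        by auto
      then have "Y \<inter> tail_space i = Z"
        using pivots_span_insert(2)[of Z S v i] less by (auto simp: pivot_cell_def)
      moreover have "v \<in> Y" using p vec.span_base[of v "insert v Z"] by auto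
      ultimately show "p \<in> {v \<in> Y. v \<noteq> 0 \<and> lead v = i} \<times> {Y \<inter> tail_space i}" using p by auto
    next
      fix p assume "p \<in> {v \<in> Y. v \<noteq> 0 \<and> lead v = i} \<times> {Y \<inter> tail_space i}"
      then obtain v where v: "p = (v, Y \<inter> tail_space i)" "v \<in> Y" "v \<noteq> 0" "lead v = i" by auto
      then have "?f p = Y" using P(3)[of v] by simp
      then show "p \<in> {p \<in> ?A. ?f p = Y}" using v P(1) sub by (simp add: pivot_cell_def)
    qed
    moreover have "card (Y - tail_space i) = card Y - card (Y \<inter> tail_space i)"
      by (simp add: card_Diff_subset_Int)
    ultimately show ?thesis
      using card_if_pivots[OF Ys piv] card_if_pivots[OF sub P(1)] P(2) insert card_insert_smaller[of S i]
      by (simp add: card_cartesian_product algebra_simps)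
  qed
  have img: "?f ` ?A \<subseteq> pivot_cell (insert i S)"
    using pivots_span_insert(1)[OF _ _ _ _ less] by (auto simp: pivot_cell_def)
  have "card ?A = card (pivot_cell (insert i S) :: ('a ^ 'n) set set) * (?q ^ ?k * (?q - 1))"
    by (rule card_eq_card_times_fiber[OF _ img _ fiber]) (rule finite)+
  then have "(card (pivot_cell (insert i S) :: ('a ^ 'n) set set) * ?q ^ ?k) * (?q - 1)
      = (?q ^ (CARD('n) - i) * card (pivot_cell S :: ('a ^ 'n) set set)) * (?q - 1)"
    by (simp only: card_cartesian_product card_lead_eq[OF i] mult_ac)
  then have e: "card (pivot_cell (insert i S) :: ('a ^ 'n) set set) * ?q ^ ?k
      = ?q ^ (CARD('n) - i) * card (pivot_cell S :: ('a ^ 'n) set set)"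
    using q by (metis mult_right_cancel)
  \<comment> \<open>The elements of \<open>S\<close> are distinct indices above \<open>i\<close>, so
    the exponent n - i - k is not truncated.\<close>
  have "S \<subseteq> {i<..CARD('n)}" using insert less by auto
  then have "?k \<le> CARD('n) - i" using card_mono[of "{i<..CARD('n)}" S] by simp
  then have "?q ^ (CARD('n) - i) = ?q ^ (CARD('n) - i - ?k) * ?q ^ ?k"
    by (metis le_add_diff_inverse2 power_add)
  with e have "card (pivot_cell (insert i S) :: ('a ^ 'n) set set) * ?q ^ ?k
      = (?q ^ (CARD('n) - i - ?k) * card (pivot_cell S :: ('a ^ 'n) set set)) * ?q ^ ?k"
    by (simp only: mult_ac)
  moreover have "?q ^ ?k \<noteq> 0" by simp
  ultimately have "card (pivot_cell (insert i S) :: ('a ^ 'n) set set)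
      = ?q ^ (CARD('n) - i - ?k) * card (pivot_cell S :: ('a ^ 'n) set set)"
    by (metis mult_right_cancel)
  moreover have "cell_dim (insert i S) = cell_dim S + (CARD('n) - i - ?k)"
    unfolding cell_dim_def using sum_desc_nth_insert_smaller[OF insert.hyps(1) less, of "\<lambda>i j. CARD('n) + 1 - i - j"] by simp
  ultimately show ?case using insert by (simp add: power_add)
qed

section \<open>Weights of vectors and subspaces\<close>

definition vector_weight :: "(nat \<Rightarrow> real) \<Rightarrow> 'a::{field,finite} ^ 'n \<Rightarrow> real" where
  "vector_weight x v = x (lead v) / real CARD('a) ^ (CARD('n) - lead v) / (real CARD('a) - 1)"

text \<open>As \<open>vector_weight\<close> spreads the weight of a line evenly over its q - 1
  nonzero vectors, this is the total weight of the lines in \<open>Y\<close>, the future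
  eigenvalue.\<close>

definition subspace_weight :: "(nat \<Rightarrow> real) \<Rightarrow> ('a::{field,finite} ^ 'n) set \<Rightarrow> real" where
  "subspace_weight x Y = (\<Sum>v\<in>Y - {0}. vector_weight x v)"

text \<open>Besides its part in the tail space of the smallest pivot \<open>i\<close>, the space
  \<open>Y\<close> has q^k (q-1) vectors, all led by \<open>i\<close>. Together they weigh x_i /
  q^(n-i-k), which is the summand for j = k + 1 of the eigenvalue.\<close>

lemma subspace_weight_eq_eigenvalue:
  fixes Y :: "('a::{field,finite} ^ 'n) set"
  assumes "finite S" "S \<subseteq> {1..CARD('n)}" "Y \<in> pivot_cell S"
  shows "subspace_weight x Y = tsetlin_eigenvalue (real CARD('a)) CARD('n) x S"
  using assms
proof (induction S arbitrary: Y rule: finite_linorder_min_induct)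
  case empty
  then have "Y = {0}" using pivots_empty_iff by (auto simp: pivot_cell_def)
  then show ?case by (simp add: subspace_weight_def tsetlin_eigenvalue_def)
next
  case (insert i S)
  let ?q = "real CARD('a)" and ?k = "card S" and ?T = "tail_space i"
  have less: "\<And>s. s \<in> S \<Longrightarrow> i < s" using insert.hyps by blast
  have i: "i \<in> {1..CARD('n)}" using insert by auto
  have Ys: "vec.subspace Y" and piv: "pivots Y = insert i S"
    using insert.prems by (auto simp: pivot_cell_def)
  note P = pivots_insert_smaller[OF Ys piv less i]
  have sub: "vec.subspace (Y \<inter> ?T)"
    using Ys subspace_tail_space by (rule vec.subspace_inter)
  have q: "2 \<le> ?q" using field_card_ge_2[where 'a='a] by simp
  have "S \<subseteq> {i<..CARD('n)}" using insert less by auto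
  then have k: "?k \<le> CARD('n) - i" using card_mono[of "{i<..CARD('n)}" S] by simp
  have "card (Y - ?T) = card Y - card (Y \<inter> ?T)"
    by (simp add: card_Diff_subset_Int)
  then have "card (Y - ?T) = CARD('a) ^ ?k * (CARD('a) - 1)"
    using card_if_pivots[OF Ys piv] card_if_pivots[OF sub P(1)] insert card_insert_smaller[of S i]
    by (simp add: algebra_simps)
  then have c: "real (card (Y - ?T)) = ?q ^ ?k * (?q - 1)"
    using q by (simp add: of_nat_diff)
  have 0: "0 \<in> ?T" by (rule vec.subspace_0[OF subspace_tail_space])
  have "subspace_weight x Y = (\<Sum>v\<in>(Y \<inter> ?T - {0}) \<union> (Y - ?T). vector_weight x v)"
    unfolding subspace_weight_def using 0 by (intro sum.cong) auto
  also have "\<dots> = subspace_weight x (Y \<inter> ?T) + (\<Sum>v\<in>Y - ?T. vector_weight x v)"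
    unfolding subspace_weight_def by (intro sum.union_disjoint) auto
  also have "subspace_weight x (Y \<inter> ?T) = tsetlin_eigenvalue ?q CARD('n) x S"
    using insert.IH[of "Y \<inter> ?T"] insert.prems sub P(1) by (simp add: pivot_cell_def)
  also have "(\<Sum>v\<in>Y - ?T. vector_weight x v) = (\<Sum>v\<in>Y - ?T. x i / ?q ^ (CARD('n) - i) / (?q - 1))"
  proof (intro sum.cong refl)
    fix v assume "v \<in> Y - ?T"
    then have "lead v = i" using P(2) by blast
    then show "vector_weight x v = x i / ?q ^ (CARD('n) - i) / (?q - 1)" by (simp add: vector_weight_def)
  qed
  also have "\<dots> = x i * ?q ^ ?k / ?q ^ (CARD('n) - i)"
    using c q by simp
  also have "\<dots> = x i / ?q ^ (CARD('n) - i - ?k)"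
  proof -
    have "?q ^ (CARD('n) - i) = ?q ^ (CARD('n) - i - ?k) * ?q ^ ?k"
      using k by (metis le_add_diff_inverse2 power_add)
    moreover have "?q ^ ?k \<noteq> 0" using q by simp
    ultimately show ?thesis by simp
  qed
  also have "CARD('n) - i - ?k = CARD('n) + 1 - i - Suc ?k" by simp
  also have "tsetlin_eigenvalue ?q CARD('n) x S + x i / ?q ^ (CARD('n) + 1 - i - Suc ?k)
      = tsetlin_eigenvalue ?q CARD('n) x (insert i S)"
    unfolding tsetlin_eigenvalue_def by (rule sum_desc_nth_insert_smaller[OF insert.hyps(1) less, symmetric])
  finally show ?case .
qed

end

section \<open>The action of words on flags\<close>

lemma set_plus_span_singleton:
  fixes X :: "('a::field ^ 'n::finite) set"
  assumes X: "vec.subspace X"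
  shows "X + vec.span {v} = vec.span (insert v X)"
proof (intro subset_antisym subsetI)
  fix z assume "z \<in> X + vec.span {v}"
  then obtain x y where "z = x + y" "x \<in> X" "y \<in> vec.span {v}" by (rule set_plus_elim)
  then show "z \<in> vec.span (insert v X)"
    using vec.span_mono[of "{v}" "insert v X"] by (auto intro!: vec.span_add intro: vec.span_base)
next
  fix z assume "z \<in> vec.span (insert v X)"
  then obtain c where "z - c *s v \<in> vec.span X" using vec.span_breakdown_eq[of z v X] by blast
  then have "z - c *s v \<in> X" using X vec.span_eq_iff by metis
  moreover have "c *s v \<in> vec.span {v}" by (intro vec.span_scale vec.span_base) simp
  ultimately have "(z - c *s v) + c *s v \<in> X + vec.span {v}" by (rule set_plus_intro)
  then show "z \<in> X + vec.span {v}" by simp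
qed

lemma span_insert_span: "vec.span (insert v (vec.span A)) = vec.span (insert v A)"
  using vec.span_mono[of A "insert v A"] vec.span_superset[of A]
  by (subst vec.span_eq) (auto intro: vec.span_base)

text \<open>A description by neighbouring members, whose positions need not be known. It suits lists
  produced by \<open>remdups_adj\<close>, where the position of the removed repetition depends on
  the line.\<close>

lemma complete_flags_iff_successively:
  fixes F :: "('a::field ^ 'n::finite) set list"
  shows "F \<in> complete_flags \<longleftrightarrow> F \<noteq> [] \<and> (\<forall>X\<in>set F. vec.subspace X)
    \<and> successively (\<lambda>U W. U \<subseteq> W \<and> vec.dim W = Suc (vec.dim U)) F
    \<and> vec.dim (hd F) = 0 \<and> vec.dim (last F) = CARD('n)" (is "_ \<longleftrightarrow> ?R")
proof
  assume "F \<in> complete_flags"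
  then have len: "length F = CARD('n) + 1"
    and d: "\<And>i. i \<le> CARD('n) \<Longrightarrow> vec.subspace (F ! i)" "\<And>i. i \<le> CARD('n) \<Longrightarrow> vec.dim (F ! i) = i"
    and s: "\<And>i. i < CARD('n) \<Longrightarrow> F ! i \<subseteq> F ! (i + 1)"
    by (simp_all add: complete_flags_def)
  have ne: "F \<noteq> []" using len by auto
  moreover have "\<forall>X\<in>set F. vec.subspace X"
    using len d(1) by (auto simp: in_set_conv_nth)
  moreover have "successively (\<lambda>U W. U \<subseteq> W \<and> vec.dim W = Suc (vec.dim U)) F"
    unfolding successively_conv_nth
  proof (intro allI impI)
    fix i assume "Suc i < length F"
    then have "i < CARD('n)" using len by simp
    then show "F ! i \<subseteq> F ! Suc i \<and> vec.dim (F ! Suc i) = Suc (vec.dim (F ! i))"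
      using s[of i] d(2)[of i] d(2)[of "Suc i"] by simp
  qed
  moreover have "vec.dim (hd F) = 0" using d(2)[of 0] by (simp add: hd_conv_nth[OF ne])
  moreover have "vec.dim (last F) = CARD('n)" using d(2)[of "CARD('n)"] by (simp add: last_conv_nth[OF ne] len)
  ultimately show ?R by blast
next
  assume R: ?R
  then have ne: "F \<noteq> []" by blast
  have s: "F ! i \<subseteq> F ! Suc i" "vec.dim (F ! Suc i) = Suc (vec.dim (F ! i))" if "Suc i < length F" for i
    using R that by (auto simp: successively_conv_nth)
  have d: "vec.dim (F ! i) = i" if "i < length F" for i
    using that
  proof (induction i)
    case 0
    then show ?case using R hd_conv_nth[OF ne] by metis
  next
    case (Suc i)
    then show ?case using s(2)[of i] by simp
  qed
  have "vec.dim (F ! (length F - 1)) = length F - 1" by (rule d) (use ne in simp)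
  then have "length F - 1 = CARD('n)" using R by (simp add: last_conv_nth[OF ne])
  then have "length F = CARD('n) + 1" using ne by (cases F) auto
  then show "F \<in> complete_flags" using R s(1) d by (auto simp: complete_flags_def)
qed

section \<open>Members of a flag and insertion of a line\<close>

lemma flag_props:
  fixes F :: "('a::field ^ 'n::finite) set list"
  assumes "F \<in> complete_flags"
  shows flag_length: "length F = CARD('n) + 1"
    and flag_subspace: "X \<in> set F \<Longrightarrow> vec.subspace X"
    and flag_nth_dim: "X \<in> set F \<Longrightarrow> F ! vec.dim X = X"
    and flag_dim_nth: "i \<le> CARD('n) \<Longrightarrow> vec.dim (F ! i) = i"
    and flag_mono: "i \<le> j \<Longrightarrow> j \<le> CARD('n) \<Longrightarrow> F ! i \<subseteq> F ! j"
    and flag_zero: "F ! 0 = {0}"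
    and flag_UNIV: "F ! CARD('n) = UNIV"
proof -
  show len: "length F = CARD('n) + 1"
    and dim: "i \<le> CARD('n) \<Longrightarrow> vec.dim (F ! i) = i" for i
    using assms by (simp_all add: complete_flags_def)
  have sub: "i \<le> CARD('n) \<Longrightarrow> vec.subspace (F ! i)" for i
    using assms by (simp add: complete_flags_def)
  show "X \<in> set F \<Longrightarrow> vec.subspace X"
    using sub len by (auto simp: in_set_conv_nth)
  show "X \<in> set F \<Longrightarrow> F ! vec.dim X = X"
    using dim len by (auto simp: in_set_conv_nth)
  show "i \<le> j \<Longrightarrow> j \<le> CARD('n) \<Longrightarrow> F ! i \<subseteq> F ! j"
  proof (induction j rule: dec_induct)
    case (step j)
    then have "F ! j \<subseteq> F ! (j + 1)" using assms by (simp add: complete_flags_def)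
    then show ?case using step by auto
  qed simp
  show "F ! 0 = {0}"
    using dim[of 0] vec.subspace_0[OF sub[of 0]] vec.dim_eq_0[of "F ! 0"] by auto
  show "F ! CARD('n) = UNIV"
    by (rule vec.subspace_dim_equal) (use sub dim in \<open>simp_all add: vec_dim_card del: vec.dim_UNIV\<close>)
qed

text \<open>A flag has one member in each dimension, so flags can be compared as sets of subspaces,
  and one inclusion suffices.\<close>

lemma flag_subset_imp_eq:
  fixes F G :: "('a::field ^ 'n::finite) set list"
  assumes F: "F \<in> complete_flags" and G: "G \<in> complete_flags" and sub: "set F \<subseteq> set G"
  shows "F = G"
proof (rule nth_equalityI)
  show "length F = length G" using flag_length[OF F] flag_length[OF G] by simp
  fix i assume i: "i < length F"
  then have "F ! i \<in> set G" using sub nth_mem by blast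
  then have "G ! vec.dim (F ! i) = F ! i" by (rule flag_nth_dim[OF G])
  then show "F ! i = G ! i" using flag_dim_nth[OF F, of i] i flag_length[OF F] by simp
qed

text \<open>The first entry \<open>L\<close> and the last entry are also sums with \<open>L\<close>,
  namely of the zero space and of the whole space. Thus all members are treated uniformly.\<close>

lemma flag_insert_eq_remdups_adj:
  fixes F :: "('a::field ^ 'n::finite) set list"
  assumes F: "F \<in> complete_flags"
  shows "flag_insert F (vec.span {v}) = remdups_adj ({0} # map (\<lambda>X. vec.span (insert v X)) F)"
proof -
  let ?n = "CARD('n)" and ?g = "\<lambda>X. vec.span (insert v X)"
  have "?n \<ge> 1" by (simp add: Suc_leI)
  then have "[0..<?n + 1] = 0 # [1..<?n] @ [?n]"
    by (simp add: upt_conv_Cons)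
  moreover have "F = map ((!) F) [0..<?n + 1]"
    using map_nth[of F] flag_length[OF F] by simp
  ultimately have "map ?g F = ?g (F ! 0) # map (\<lambda>i. ?g (F ! i)) [1..<?n] @ [?g (F ! ?n)]"
    by (metis (no_types, lifting) list.simps(8,9) map_append map_map comp_apply map_cong)
  moreover have "map (\<lambda>i. F ! i + vec.span {v}) [1..<?n] = map (\<lambda>i. ?g (F ! i)) [1..<?n]"
    using flag_subspace[OF F] flag_length[OF F] by (intro map_cong refl set_plus_span_singleton) auto
  moreover have "?g (F ! 0) = vec.span {v}"
    unfolding flag_zero[OF F] by (simp only: insert_commute[of v 0 "{}"] vec.span_insert_0)
  moreover have "?g (F ! ?n) = F ! ?n" unfolding flag_UNIV[OF F] by simp
  ultimately show ?thesis unfolding flag_insert_def flag_zero[OF F] by (simp only:)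
qed

text \<open>Before repetitions are removed, each step raises the dimension by at most one. Removal
  makes all inclusions strict, so each step raises it by exactly one.\<close>

lemma flag_insert_props:
  fixes F :: "('a::field ^ 'n::finite) set list"
  assumes F: "F \<in> complete_flags" and v: "v \<noteq> 0"
  shows flag_insert_complete: "flag_insert F (vec.span {v}) \<in> complete_flags"
    and set_flag_insert: "set (flag_insert F (vec.span {v}))
      = insert {0} ((\<lambda>X. vec.span (insert v X)) ` set F)"
proof -
  let ?n = "CARD('n)" and ?g = "\<lambda>X. vec.span (insert v X)"
  let ?Z = "{0} # map ?g F"
  let ?R = "\<lambda>U W :: ('a ^ 'n) set. U \<subseteq> W \<and> vec.dim W \<le> Suc (vec.dim U)"
  note eq = flag_insert_eq_remdups_adj[OF F, of v]
  note len = flag_length[OF F]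
  show "set (flag_insert F (vec.span {v})) = insert {0} (?g ` set F)"
    unfolding eq by simp
  have sub: "\<forall>X\<in>set ?Z. vec.subspace X" by (auto simp: vec.subspace_span vec.subspace_0)
  have dg: "vec.dim (?g X) = (if v \<in> X then vec.dim X else Suc (vec.dim X))" if "X \<in> set F" for X
    using flag_subspace[OF F that] dim_span_insert[of X v] by (simp add: insert_absorb)
  have succ: "successively ?R ?Z"
    unfolding successively_conv_nth
  proof (intro allI impI)
    fix i assume i: "Suc i < length ?Z"
    show "?R (?Z ! i) (?Z ! Suc i)"
    proof (cases i)
      case 0
      have "F ! 0 \<in> set F" using len by (intro nth_mem) simp
      then have "vec.dim (?g (F ! 0)) \<le> 1"
        using dg[of "F ! 0"] flag_dim_nth[OF F, of 0] by (simp del: vec.dim_eq_0)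
      then show ?thesis using 0 i vec.span_zero by auto
    next
      case (Suc j)
      then have j: "Suc j < length F" using i by simp
      then have jn: "Suc j \<le> CARD('n)" using len by simp
      have s: "F ! j \<subseteq> F ! Suc j" using flag_mono[OF F, of j "Suc j"] jn by simp
      then have "?g (F ! j) \<subseteq> ?g (F ! Suc j)" by (intro vec.span_mono) auto
      \<comment> \<open>If \<open>v\<close> lies in a member, it lies in the next one. Hence the
        dimension cannot stay at the first and rise at the second, and no step exceeds one.\<close>
      moreover have "vec.dim (?g (F ! Suc j)) \<le> Suc (vec.dim (?g (F ! j)))"
        using dg[of "F ! j"] dg[of "F ! Suc j"] s j jn flag_dim_nth[OF F, of j] flag_dim_nth[OF F, of "Suc j"]
        by auto
      ultimately show ?thesis using Suc j by simp
    qed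
  qed
  let ?G = "remdups_adj ?Z"
  have "successively (\<lambda>U W. U \<subseteq> W \<and> vec.dim W = Suc (vec.dim U)) ?G"
    unfolding successively_conv_nth
  proof (intro allI impI)
    fix i assume i: "Suc i < length ?G"
    have "successively ?R ?G" using succ by (rule successively_remdups_adjI)
    then have R: "?R (?G ! i) (?G ! Suc i)" using i by (simp add: successively_conv_nth)
    have "successively (\<noteq>) ?G" using distinct_adj_remdups_adj[of ?Z] by (simp only: distinct_adj_def)
    then have ne: "?G ! i \<noteq> ?G ! Suc i"
      using i by (simp only: successively_conv_nth) blast
    have "?G ! i \<in> set ?Z" "?G ! Suc i \<in> set ?Z"
      using nth_mem[of i ?G] nth_mem[of "Suc i" ?G] i by (simp_all only: remdups_adj_set Suc_lessD)
    then have s: "vec.subspace (?G ! i)" "vec.subspace (?G ! Suc i)" using sub by blast+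
    have "\<not> vec.dim (?G ! Suc i) \<le> vec.dim (?G ! i)"
      using vec.subspace_dim_equal[OF s] R ne by blast
    then show "?G ! i \<subseteq> ?G ! Suc i \<and> vec.dim (?G ! Suc i) = Suc (vec.dim (?G ! i))"
      using R by simp
  qed
  moreover have "vec.dim (last ?G) = ?n"
  proof -
    have "F \<noteq> []" using len by auto
    moreover have "last F = UNIV" using flag_UNIV[OF F] len \<open>F \<noteq> []\<close> by (simp add: last_conv_nth)
    ultimately have "last ?Z = UNIV" by (simp add: last_map)
    then show ?thesis by (simp only: last_remdups_adj vec_dim_card)
  qed
  moreover have "vec.dim (hd ?G) = 0" by (simp only: hd_remdups_adj) simp
  ultimately show "flag_insert F (vec.span {v}) \<in> complete_flags"
    unfolding eq complete_flags_iff_successively using sub by (simp del: remdups_adj.simps)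
qed

section \<open>Counting flags with a prescribed beginning\<close>

lemma finite_complete_flags: "finite (complete_flags :: ('a::{field,finite} ^ 'n::finite) set list set)"
  by (rule finite_subset[OF _ finite_lists_length_eq[of UNIV "CARD('n) + 1"]])
     (auto simp: complete_flags_def)

text \<open>The member of dimension k + 1 may be any cover of \<open>Z k\<close>, which gives
  \<open>q_number\<close> of n - k choices. Iterating up to dimension n multiplies these numbers to
  a \<open>q\<close>-factorial.\<close>

lemma card_flags_extending:
  fixes Z :: "nat \<Rightarrow> ('a::{field,finite} ^ 'n::finite) set"
  assumes "k \<le> CARD('n)" and "\<And>i. i \<le> k \<Longrightarrow> vec.subspace (Z i) \<and> vec.dim (Z i) = i"
    and "\<And>i. i < k \<Longrightarrow> Z i \<subseteq> Z (Suc i)"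
  shows "real (card {F \<in> complete_flags. \<forall>i\<le>k. F ! i = Z i}) = q_fact (real CARD('a)) (CARD('n) - k)"
  using assms
proof (induction "CARD('n) - k" arbitrary: k Z)
  case 0
  then have k: "k = CARD('n)" by simp
  let ?F = "map Z [0..<CARD('n) + 1]"
  have nth: "?F ! i = Z i" if "i \<le> CARD('n)" for i
    using that by (simp del: upt_Suc)
  have F: "?F \<in> complete_flags"
    unfolding complete_flags_def using 0 k nth by (auto simp del: upt_Suc)
  have eqF: "F = ?F" if "F \<in> complete_flags" "\<forall>i\<le>k. F ! i = Z i" for F
    using that k nth flag_length[OF that(1)] by (intro nth_equalityI) (simp_all del: upt_Suc)
  have "{F \<in> complete_flags. \<forall>i\<le>k. F ! i = Z i} = {?F}"
  proof (intro subset_antisym subsetI)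
    fix F assume "F \<in> {F \<in> complete_flags. \<forall>i\<le>k. F ! i = Z i}"
    then show "F \<in> {?F}" using eqF by blast
  next
    fix F assume "F \<in> {?F}"
    then have "F = ?F" by (rule singletonD)
    then show "F \<in> {F \<in> complete_flags. \<forall>i\<le>k. F ! i = Z i}" using F nth k by blast
  qed
  then show ?case using k by simp
next
  case (Suc m)
  let ?A = "\<lambda>W. {F \<in> complete_flags. \<forall>i\<le>Suc k. F ! i = (Z(Suc k := W)) i}"
  have k: "k < CARD('n)" using Suc.hyps by simp
  have Zk: "vec.subspace (Z k)" "vec.dim (Z k) = k" using Suc.prems by auto
  have "{F \<in> complete_flags. \<forall>i\<le>k. F ! i = Z i} = (\<Union>W\<in>covers (Z k) UNIV. ?A W)"
  proof (intro subset_antisym subsetI)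
    fix F assume "F \<in> {F \<in> complete_flags. \<forall>i\<le>k. F ! i = Z i}"
    then have F: "F \<in> complete_flags" and Z: "\<forall>i\<le>k. F ! i = Z i" by auto
    have "F ! Suc k \<in> set F" using flag_length[OF F] k by (intro nth_mem) simp
    then have "F ! Suc k \<in> covers (Z k) UNIV"
      using flag_subspace[OF F] flag_dim_nth[OF F, of "Suc k"] flag_mono[OF F, of k "Suc k"] k Z Zk
      by (auto simp: covers_def)
    moreover have "F \<in> ?A (F ! Suc k)" using F Z by (auto simp: le_Suc_eq)
    ultimately show "F \<in> (\<Union>W\<in>covers (Z k) UNIV. ?A W)" by blast
  next
    fix F assume "F \<in> (\<Union>W\<in>covers (Z k) UNIV. ?A W)"
    then obtain W where "F \<in> ?A W" by blast
    then have F: "F \<in> complete_flags" and Z: "\<And>i. i \<le> Suc k \<Longrightarrow> F ! i = (Z(Suc k := W)) i" by auto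
    have "F ! i = Z i" if "i \<le> k" for i using Z[of i] that by simp
    then show "F \<in> {F \<in> complete_flags. \<forall>i\<le>k. F ! i = Z i}" using F by blast
  qed
  also have "card \<dots> = (\<Sum>W\<in>covers (Z k) UNIV. card (?A W))"
  proof (intro card_UN_disjoint ballI impI)
    fix U W :: "('a ^ 'n) set" assume "U \<noteq> W"
    show "?A U \<inter> ?A W = {}"
    proof (rule ccontr)
      assume "?A U \<inter> ?A W \<noteq> {}"
      then obtain F where "F ! Suc k = (Z(Suc k := U)) (Suc k)" "F ! Suc k = (Z(Suc k := W)) (Suc k)" by blast
      then show False using \<open>U \<noteq> W\<close> by simp
    qed
  qed (auto intro: finite_subset[OF _ finite_complete_flags])
  also have "real \<dots> = (\<Sum>W\<in>covers (Z k) UNIV. q_fact (real CARD('a)) (CARD('n) - Suc k))"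
    unfolding of_nat_sum
  proof (intro sum.cong refl)
    fix W assume W: "W \<in> covers (Z k) UNIV"
    have "m = CARD('n) - Suc k" using Suc.hyps by simp
    then show "real (card (?A W)) = q_fact (real CARD('a)) (CARD('n) - Suc k)"
      by (rule Suc.hyps(1)) (use W Suc.prems Zk k in \<open>auto simp: covers_def le_Suc_eq less_Suc_eq\<close>)
  qed
  also have "\<dots> = q_number (real CARD('a)) (CARD('n) - k) * q_fact (real CARD('a)) (CARD('n) - Suc k)"
    using card_covers[OF Zk(1) vec.subspace_UNIV] Zk(2) by (simp add: vec_dim_card del: vec.dim_UNIV)
  also have "\<dots> = q_fact (real CARD('a)) (CARD('n) - k)"
    using k q_fact_Suc[of "real CARD('a)" "CARD('n) - Suc k"] Suc_diff_Suc[OF k] by simp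
  finally show ?case .
qed

section \<open>Words of vectors acting on flags\<close>

definition word_act :: "('a::field ^ 'n::finite) list \<Rightarrow> ('a ^ 'n) set list \<Rightarrow> ('a ^ 'n) set list" where
  "word_act P F = foldr (\<lambda>v G. flag_insert G (vec.span {v})) P F"

text \<open>The spans of the initial segments of the word: the part of the resulting flag that does
  not depend on the initial flag.\<close>

primrec word_chain :: "('a::field ^ 'n::finite) list \<Rightarrow> ('a ^ 'n) set set" where
  "word_chain [] = {{0}}"
| "word_chain (v # P) = insert {0} ((\<lambda>X. vec.span (insert v X)) ` word_chain P)"

text \<open>The last letter acts first. Thus one more step of the operator before \<open>P\<close>
  appends a letter on the right of the word.\<close>

lemma word_act_Nil [simp]: "word_act [] F = F"
  and word_act_Cons [simp]: "word_act (v # P) F = flag_insert (word_act P F) (vec.span {v})"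
  and word_act_snoc: "word_act (P @ [v]) F = word_act P (flag_insert F (vec.span {v}))"
  by (simp_all add: word_act_def)

lemma word_act_complete:
  "F \<in> complete_flags \<Longrightarrow> 0 \<notin> set P \<Longrightarrow> word_act P F \<in> complete_flags"
  by (induction P) (auto intro!: flag_insert_complete)

lemma set_word_act:
  fixes F :: "('a::field ^ 'n::finite) set list"
  assumes F: "F \<in> complete_flags" and "0 \<notin> set P"
  shows "set (word_act P F) = word_chain P \<union> (\<lambda>X. vec.span (set P \<union> X)) ` set F"
  using assms(2)
proof (induction P)
  case Nil
  have "F ! 0 \<in> set F" using flag_length[OF F] by (intro nth_mem) simp
  then have "{0} \<in> set F" using flag_zero[OF F] by simp
  moreover have "(\<lambda>X. vec.span X) ` set F = set F"
    using flag_subspace[OF F] vec.span_eq_iff by (metis (no_types, lifting) image_cong image_ident)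
  ultimately show ?case by auto
next
  case (Cons v P)
  have v: "v \<noteq> 0" and P: "0 \<notin> set P" using Cons.prems by auto
  have "set (word_act (v # P) F) = insert {0} ((\<lambda>X. vec.span (insert v X)) ` set (word_act P F))"
    using set_flag_insert[OF word_act_complete[OF F P] v] by simp
  also have "\<dots> = word_chain (v # P) \<union> (\<lambda>X. vec.span (set (v # P) \<union> X)) ` set F"
    unfolding Cons.IH[OF P] by (simp add: image_Un image_image span_insert_span)
  finally show ?case .
qed

lemma span_set_in_word_chain: "vec.span (set P) \<in> word_chain P"
proof (induction P)
  case (Cons v P)
  have "vec.span (set (v # P)) = vec.span (insert v (vec.span (set P)))" by (simp add: span_insert_span)
  then show ?case using Cons by simp
qed simp

lemma word_chain_subset: "X \<in> word_chain P \<Longrightarrow> X \<subseteq> vec.span (set P)"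
proof (induction P arbitrary: X)
  case (Cons v P)
  then consider "X = {0}" | Y where "Y \<in> word_chain P" "X = vec.span (insert v Y)" by auto
  then show ?case
  proof cases
    case 1
    then show ?thesis by (simp add: vec.span_zero)
  next
    case 2
    then have "insert v Y \<subseteq> vec.span (set (v # P))"
      using Cons.IH[of Y] vec.span_mono[of "set P" "set (v # P)"] by (auto intro: vec.span_base)
    then show ?thesis unfolding 2(2) by (intro vec.span_minimal vec.subspace_span)
  qed
qed simp

text \<open>The left regular band property, on which the whole argument rests.\<close>

lemma word_act_absorb:
  fixes F :: "('a::field ^ 'n::finite) set list"
  assumes F: "F \<in> complete_flags" and P: "0 \<notin> set P" and v: "v \<noteq> 0" "v \<in> vec.span (set P)"
  shows "word_act P (flag_insert F (vec.span {v})) = word_act P F"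
proof (rule flag_subset_imp_eq)
  note G = flag_insert_complete[OF F v(1)]
  show "word_act P (flag_insert F (vec.span {v})) \<in> complete_flags" "word_act P F \<in> complete_flags"
    using F G P by (auto intro: word_act_complete)
  \<comment> \<open>Comparing members suffices. The extra zero space contributes only the span of
    the word, and adjoining \<open>v\<close> to \<open>X\<close> is invisible once that span is
    added.\<close>
  have 1: "vec.span (set P \<union> {0}) = vec.span (set P)" by simp
  have 2: "vec.span (set P \<union> vec.span (insert v X)) = vec.span (set P \<union> X)" for X
  proof (subst vec.span_eq, intro conjI)
    have "vec.span (insert v X) \<subseteq> vec.span (set P \<union> X)"
      using v(2) vec.span_mono[of "set P" "set P \<union> X"]
      by (intro vec.span_minimal) (auto intro: vec.span_base)
    then show "set P \<union> vec.span (insert v X) \<subseteq> vec.span (set P \<union> X)" by (auto intro: vec.span_base)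
    have "X \<subseteq> vec.span (insert v X)" using vec.span_superset[of "insert v X"] by auto
    then show "set P \<union> X \<subseteq> vec.span (set P \<union> vec.span (insert v X))" by (auto intro: vec.span_base)
  qed
  show "set (word_act P (flag_insert F (vec.span {v}))) \<subseteq> set (word_act P F)"
    unfolding set_word_act[OF G P] set_word_act[OF F P] set_flag_insert[OF F v(1)]
    using span_set_in_word_chain[of P] by (auto simp: 1 2 image_iff)
qed

text \<open>If the chain lies in \<open>F\<close>, so does the span of \<open>P\<close>. Adding this
  span to another member gives the larger of the two, so the action produces only members of
  \<open>F\<close>.\<close>

lemma word_act_fixed_iff:
  fixes F :: "('a::field ^ 'n::finite) set list"
  assumes F: "F \<in> complete_flags" and P: "0 \<notin> set P"
  shows "word_act P F = F \<longleftrightarrow> word_chain P \<subseteq> set F"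
proof
  assume "word_act P F = F"
  then show "word_chain P \<subseteq> set F" using set_word_act[OF F P] by auto
next
  assume sub: "word_chain P \<subseteq> set F"
  let ?U = "vec.span (set P)"
  have U: "?U \<in> set F" using sub span_set_in_word_chain by blast
  have "vec.span (set P \<union> X) \<in> set F" if X: "X \<in> set F" for X
  proof -
    have eq: "vec.span (set P \<union> X) = vec.span (?U \<union> X)"
      using vec.span_mono[of "set P" "set P \<union> X"] vec.span_superset[of "set P"]
      by (subst vec.span_eq) (auto intro: vec.span_base)
    obtain i j where ij: "i \<le> CARD('n)" "j \<le> CARD('n)" "?U = F ! i" "X = F ! j"
      using U X flag_length[OF F] by (auto simp: in_set_conv_nth less_Suc_eq_le)
    have "?U \<union> X = ?U \<or> ?U \<union> X = X"
      using flag_mono[OF F, of i j] flag_mono[OF F, of j i] ij by (cases "i \<le> j") auto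
    moreover have "vec.span ?U = ?U" "vec.span X = X"
      using flag_subspace[OF F] U X vec.span_eq_iff by blast+
    ultimately show ?thesis using U X eq by metis
  qed
  then have "set (word_act P F) \<subseteq> set F" using sub by (auto simp: set_word_act[OF F P])
  then show "word_act P F = F" by (rule flag_subset_imp_eq[OF word_act_complete[OF F P] F])
qed

lemma complete_flags_nonempty: "(complete_flags :: ('a::{field,finite} ^ 'n::finite) set list set) \<noteq> {}"
proof
  assume e: "(complete_flags :: ('a ^ 'n) set list set) = {}"
  have "real (card {F \<in> complete_flags. \<forall>i\<le>0. F ! i = {0 :: 'a ^ 'n}}) = q_fact (real CARD('a)) (CARD('n) - 0)"
    by (rule card_flags_extending) (auto simp: vec.subspace_0)
  then show False using e q_fact_pos[of "real CARD('a)" "CARD('n)"] by simp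
qed

text \<open>The chain of the word consists of one space in each dimension up to that of its span, so
  the fixed flags are those with a prescribed beginning.\<close>

lemma card_fixed_flags:
  fixes P :: "('a::{field,finite} ^ 'n::finite) list"
  assumes P: "0 \<notin> set P"
  shows "real (card {F \<in> complete_flags. word_act P F = F})
    = q_fact (real CARD('a)) (CARD('n) - vec.dim (vec.span (set P)))"
proof -
  obtain F0 :: "('a ^ 'n) set list" where F0: "F0 \<in> complete_flags" using complete_flags_nonempty by auto
  \<comment> \<open>An arbitrary flag is moved by the word only to exhibit the chain as the
    beginning of a flag.\<close>
  define G where "G = word_act P F0"
  let ?U = "vec.span (set P)" and ?k = "vec.dim (vec.span (set P))"
  have G: "G \<in> complete_flags" unfolding G_def using F0 P by (rule word_act_complete)
  have setG: "set G = word_chain P \<union> (\<lambda>X. vec.span (set P \<union> X)) ` set F0"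
    unfolding G_def using F0 P by (rule set_word_act)
  have k: "?k \<le> CARD('n)" by (rule dim_subset_UNIV_cart_gen)
  have chain: "word_chain P = {G ! i | i. i \<le> ?k}"
  proof (intro subset_antisym subsetI)
    fix X assume X: "X \<in> word_chain P"
    then have "X = G ! vec.dim X" using flag_nth_dim[OF G, of X] setG by simp
    moreover have "vec.dim X \<le> ?k" using word_chain_subset[OF X] by (rule vec.dim_subset)
    ultimately show "X \<in> {G ! i | i. i \<le> ?k}" by blast
  next
    fix X assume "X \<in> {G ! i | i. i \<le> ?k}"
    then obtain i where i: "i \<le> ?k" "X = G ! i" by blast
    have XG: "X \<in> set G" unfolding i(2) using flag_length[OF G] i k by (intro nth_mem) simp
    have dX: "vec.dim X = i" using flag_dim_nth[OF G, of i] i k by simp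
    show "X \<in> word_chain P"
    proof (rule ccontr)
      assume "X \<notin> word_chain P"
      \<comment> \<open>Members outside the chain contain the span of the word. By its dimension
        \<open>X\<close> then equals that span, which does belong to the chain.\<close>
      then obtain Y where Y: "X = vec.span (set P \<union> Y)" using XG setG by auto
      then have "?U \<subseteq> X" by (simp add: vec.span_mono)
      moreover have "vec.subspace X" unfolding Y by (rule vec.subspace_span)
      ultimately have "?U = X" using i(1) dX by (intro vec.subspace_dim_equal) (simp_all only: vec.subspace_span)
      then show False using \<open>X \<notin> word_chain P\<close> span_set_in_word_chain by metis
    qed
  qed
  have "{F \<in> complete_flags. word_act P F = F} = {F \<in> complete_flags. \<forall>i\<le>?k. F ! i = G ! i}"
  proof (intro Collect_cong conj_cong refl)
    fix F :: "('a ^ 'n) set list" assume F: "F \<in> complete_flags"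
    have "G ! i \<in> set F \<longleftrightarrow> F ! i = G ! i" if "i \<le> ?k" for i
    proof
      assume "G ! i \<in> set F"
      then show "F ! i = G ! i" using flag_nth_dim[OF F] flag_dim_nth[OF G, of i] that k by fastforce
    next
      assume "F ! i = G ! i"
      then show "G ! i \<in> set F" using flag_length[OF F] that k by (metis Suc_eq_plus1 le_imp_less_Suc le_trans nth_mem)
    qed
    then show "word_act P F = F \<longleftrightarrow> (\<forall>i\<le>?k. F ! i = G ! i)"
      unfolding word_act_fixed_iff[OF F P] chain by auto
  qed
  also have "real (card \<dots>) = q_fact (real CARD('a)) (CARD('n) - ?k)"
    using k flag_subspace[OF G] flag_length[OF G] flag_dim_nth[OF G] flag_mono[OF G]
    by (intro card_flags_extending) auto
  finally show ?thesis .
qed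

section \<open>Annihilation and traces\<close>

context ordered_basis
begin

section \<open>From sums over lines to sums over nonzero vectors\<close>

lemma span_singleton_in_lines:
  fixes v :: "'a::field ^ 'n"
  shows "v \<noteq> 0 \<Longrightarrow> vec.span {v} \<in> lines"
  by (simp add: lines_def vec.subspace_span)

lemma line_eq_span_singleton:
  fixes v :: "'a::field ^ 'n"
  assumes "L \<in> lines" "v \<in> L" "v \<noteq> 0"
  shows "vec.span {v} = L"
proof (rule vec.subspace_dim_equal)
  show "vec.span {v} \<subseteq> L" using assms by (intro vec.span_minimal) (auto simp: lines_def)
qed (use assms in \<open>simp_all add: lines_def vec.subspace_span\<close>)

lemma sum_nonzero_eq_sum_lines:
  fixes g :: "('a::{field,finite} ^ 'n) set \<Rightarrow> real"
  shows "(\<Sum>v\<in>UNIV - {0}. g (vec.span {v})) = (real CARD('a) - 1) * (\<Sum>L\<in>lines. g L)"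
proof -
  have "(\<Sum>v\<in>UNIV - {0}. g (vec.span {v}))
    = (\<Sum>L\<in>lines. \<Sum>v | v \<in> UNIV - {0 :: 'a ^ 'n} \<and> vec.span {v} = L. g (vec.span {v}))"
    by (rule sum.group[symmetric]) (auto intro: span_singleton_in_lines)
  also have "\<dots> = (\<Sum>L\<in>lines. (real CARD('a) - 1) * g L)"
  proof (intro sum.cong refl)
    fix L :: "('a ^ 'n) set" assume L: "L \<in> lines"
    have "{v \<in> UNIV - {0}. vec.span {v} = L} = L - {0}"
    proof (intro subset_antisym subsetI)
      fix v assume "v \<in> {v \<in> UNIV - {0}. vec.span {v} = L}"
      then show "v \<in> L - {0}" using vec.span_base[of v "{v}"] by blast
    next
      fix v assume "v \<in> L - {0}"
      then show "v \<in> {v \<in> UNIV - {0}. vec.span {v} = L}" using line_eq_span_singleton[OF L] by blast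
    qed
    moreover have "card L = CARD('a)" and "0 \<in> L"
      using L card_subspace[of L] vec.subspace_0[of L] by (auto simp: lines_def)
    ultimately have c: "real (card {v \<in> UNIV - {0}. vec.span {v} = L}) = real CARD('a) - 1"
      using field_card_ge_2[where 'a='a] by (simp add: of_nat_diff)
    have "(\<Sum>v | v \<in> UNIV - {0} \<and> vec.span {v} = L. g (vec.span {v}))
      = (\<Sum>v | v \<in> UNIV - {0} \<and> vec.span {v} = L. g L)"
      by (intro sum.cong refl) blast
    also have "\<dots> = (real CARD('a) - 1) * g L" unfolding sum_constant c ..
    finally show "(\<Sum>v | v \<in> UNIV - {0} \<and> vec.span {v} = L. g (vec.span {v}))
      = (real CARD('a) - 1) * g L" .
  qed
  finally show ?thesis by (simp only: sum_distrib_left)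
qed

definition echelon_vector :: "nat \<Rightarrow> (nat \<Rightarrow> 'a) \<Rightarrow> 'a::field ^ 'n" where
  "echelon_vector i c = std_basis b i + (\<Sum>k\<in>{i<..CARD('n)}. c k *s std_basis b k)"

lemma echelon_vector_nth:
  assumes i: "i \<in> {1..CARD('n)}" and j: "j \<in> {1..CARD('n)}"
  shows "vec_nth (echelon_vector i c) (b j) = (if j = i then 1 else if i < j then c j else 0)"
proof -
  have eq: "b j = b k \<longleftrightarrow> k = j" if "k \<in> {1..CARD('n)}" for k
    using inj_on_eq_iff[OF bij_betw_imp_inj_on[OF bij_b] that j] by (simp only: eq_commute)
  have "(\<Sum>k\<in>{i<..CARD('n)}. vec_nth (c k *s std_basis b k) (b j))
      = (\<Sum>k\<in>{i<..CARD('n)}. if k = j then c k else 0)"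
    using eq i by (intro sum.cong refl) (auto simp: std_basis_def axis_def)
  then show ?thesis
    using eq[OF i] j by (simp add: echelon_vector_def std_basis_def axis_def)
qed

lemma lead_echelon_vector: "i \<in> {1..CARD('n)} \<Longrightarrow> lead (echelon_vector i c) = i"
  by (rule lead_eqI) (auto simp: echelon_vector_nth)

text \<open>Dividing \<open>v\<close> by its leading coordinate gives the normalized generator.
  Uniqueness holds since all nonzero multiples of a vector have the same lead.\<close>

lemma line_index_span:
  fixes v :: "'a::field ^ 'n"
  assumes v: "v \<noteq> 0"
  shows "line_index b (vec.span {v}) = lead v"
  unfolding line_index_def echelon_vector_def[symmetric]
proof (rule the_equality)
  let ?i = "lead v"
  note l = lead_props[OF v]
  let ?c = "\<lambda>k. vec_nth v (b k) / vec_nth v (b ?i)"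
  have "vec_nth v (b ?i) *s echelon_vector ?i ?c = v"
  proof (subst Finite_Cartesian_Product.vec_eq_iff, rule allI)
    fix k
    have "k \<in> b ` {1..CARD('n)}" using bij_betw_imp_surj_on[OF bij_b] by simp
    then obtain j where j: "j \<in> {1..CARD('n)}" "k = b j" by blast
    have "vec_nth v (b j) = 0" if "j < ?i" using lead_le[OF j(1), of v] that by fastforce
    then show "vec_nth (vec_nth v (b ?i) *s echelon_vector ?i ?c) k = vec_nth v k"
      using echelon_vector_nth[OF l(1) j(1), of ?c] l(2) j(2) by (cases j ?i rule: linorder_cases) simp_all
  qed
  then have "echelon_vector ?i ?c = inverse (vec_nth v (b ?i)) *s v"
    using l(2) by (metis left_inverse vec.scale_one vec.scale_scale)
  moreover have "echelon_vector ?i ?c \<noteq> 0"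
    using echelon_vector_nth[OF l(1) l(1), of ?c] by auto
  ultimately have "vec.span {echelon_vector ?i ?c} = vec.span {v}"
    by (intro line_eq_span_singleton span_singleton_in_lines v) (auto intro: vec.span_scale vec.span_base)
  then show "?i \<in> {1..CARD('n)} \<and> (\<exists>c. vec.span {v} = vec.span {echelon_vector ?i c})"
    using l(1) by metis
next
  fix i assume "i \<in> {1..CARD('n)} \<and> (\<exists>c. vec.span {v} = vec.span {echelon_vector i c})"
  then obtain c where i: "i \<in> {1..CARD('n)}" and "vec.span {v} = vec.span {echelon_vector i c}" by blast
  then have "v \<in> vec.span {echelon_vector i c}" using vec.span_base[of v "{v}"] by simp
  then obtain k where k: "v = k *s echelon_vector i c" by (auto simp: vec.span_singleton)
  then have "k \<noteq> 0" using v by auto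
  then show "i = lead v" using lead_scale[of k] lead_echelon_vector[OF i] k by metis
qed

lemma tsetlin_coeff_eq:
  fixes F G :: "('a::{field,finite} ^ 'n) set list"
  shows "tsetlin_coeff b x F G
    = (\<Sum>v\<in>UNIV - {0}. vector_weight x v * of_bool (flag_insert F (vec.span {v}) = G))"
proof -
  let ?q = "real CARD('a)"
  let ?g = "\<lambda>L. line_weight b x L * of_bool (flag_insert F L = G)"
  have q: "?q - 1 \<noteq> 0" using field_card_ge_2[where 'a='a] by simp
  have "tsetlin_coeff b x F G = (\<Sum>L\<in>lines. ?g L)"
    unfolding tsetlin_coeff_def by (intro sum.mono_neutral_cong_left) auto
  also have "\<dots> = (\<Sum>v\<in>UNIV - {0}. ?g (vec.span {v})) / (?q - 1)"
    unfolding sum_nonzero_eq_sum_lines[of ?g] using q by (rule nonzero_mult_div_cancel_left[symmetric])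
  also have "\<dots> = (\<Sum>v\<in>UNIV - {0}. vector_weight x v * of_bool (flag_insert F (vec.span {v}) = G))"
    unfolding sum_divide_distrib
    by (intro sum.cong refl) (simp add: line_weight_def line_index_span vector_weight_def)
  finally show ?thesis .
qed

section \<open>The operator on functions of flags and its shifts\<close>

definition tsetlin_op ::
  "(nat \<Rightarrow> real) \<Rightarrow> (('a::{field,finite} ^ 'n) set list \<Rightarrow> real) \<Rightarrow> ('a ^ 'n) set list \<Rightarrow> real" where
  "tsetlin_op x f F = (\<Sum>v\<in>UNIV - {0}. vector_weight x v * f (flag_insert F (vec.span {v})))"

primrec shift_op_prod ::
  "(nat \<Rightarrow> real) \<Rightarrow> real list \<Rightarrow> (('a::{field,finite} ^ 'n) set list \<Rightarrow> real) \<Rightarrow> ('a ^ 'n) set list \<Rightarrow> real" where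
  "shift_op_prod x [] f = f"
| "shift_op_prod x (r # rs) f = shift_op_prod x rs (\<lambda>F. tsetlin_op x f F - r * f F)"

text \<open>Inserting a line leads from complete flags to complete flags, so the values elsewhere
  never enter.\<close>

lemma shift_op_prod_cong:
  assumes "\<And>F. F \<in> complete_flags \<Longrightarrow> f F = g F" and "F \<in> complete_flags"
  shows "shift_op_prod x rs f F = shift_op_prod x rs g F"
  using assms(1)
proof (induction rs arbitrary: f g)
  case Nil
  then show ?case using assms(2) by simp
next
  case (Cons r rs)
  have "tsetlin_op x f F = tsetlin_op x g F" if "F \<in> complete_flags" for F
    unfolding tsetlin_op_def using that by (intro sum.cong refl) (auto simp: Cons.prems flag_insert_complete)
  then show ?case using Cons.prems by (simp, intro Cons.IH) simp
qed

lemma shift_op_prod_diff: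
  "shift_op_prod x rs (\<lambda>F. f F - c * g F) F = shift_op_prod x rs f F - c * shift_op_prod x rs g F"
proof (induction rs arbitrary: f g)
  case (Cons r rs)
  have "(\<lambda>F. tsetlin_op x (\<lambda>F. f F - c * g F) F - r * (f F - c * g F))
    = (\<lambda>F. (tsetlin_op x f F - r * f F) - c * (tsetlin_op x g F - r * g F))"
    by (simp add: tsetlin_op_def algebra_simps sum_subtractf sum_distrib_left)
  then show ?case using Cons.IH by simp
qed simp

lemma shift_op_prod_sum:
  "shift_op_prod x rs (\<lambda>F. \<Sum>s\<in>A. c s * f s F) F = (\<Sum>s\<in>A. c s * shift_op_prod x rs (f s) F)"
proof (induction rs arbitrary: f)
  case (Cons r rs)
  have "tsetlin_op x (\<lambda>F. \<Sum>s\<in>A. c s * f s F) F = (\<Sum>s\<in>A. c s * tsetlin_op x (f s) F)" for F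
    unfolding tsetlin_op_def sum_distrib_left
    by (subst sum.swap) (simp add: mult.left_commute)
  then have "(\<lambda>F. tsetlin_op x (\<lambda>F. \<Sum>s\<in>A. c s * f s F) F - r * (\<Sum>s\<in>A. c s * f s F))
    = (\<lambda>F. \<Sum>s\<in>A. c s * (tsetlin_op x (f s) F - r * f s F))"
    by (simp add: sum_distrib_left right_diff_distrib sum_subtractf mult.left_commute)
  then show ?case using Cons.IH by simp
qed simp

text \<open>The recursion behind both the annihilation and the trace: applying one factor to a
  function of \<open>word_act P F\<close> extends the word by one letter.\<close>

lemma shift_op_prod_Cons_word:
  "shift_op_prod x (r # rs) (\<lambda>F. h (word_act P F)) F
    = (\<Sum>v\<in>UNIV - {0}. vector_weight x v * shift_op_prod x rs (\<lambda>F. h (word_act (P @ [v]) F)) F)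
      - r * shift_op_prod x rs (\<lambda>F. h (word_act P F)) F"
  by (simp add: tsetlin_op_def shift_op_prod_diff shift_op_prod_sum flip: word_act_snoc)

lemma vector_weight_pos:
  fixes v :: "'a::{field,finite} ^ 'n"
  assumes "\<And>i. i \<in> {1..CARD('n)} \<Longrightarrow> 0 < x i" and "v \<noteq> 0"
  shows "0 < vector_weight x v"
  using assms(1)[OF lead_props(1)[OF assms(2)]] field_card_ge_2[where 'a='a]
  by (simp add: vector_weight_def)

lemma subspace_weight_strict_mono:
  fixes X Y :: "('a::{field,finite} ^ 'n) set"
  assumes x: "\<And>i. i \<in> {1..CARD('n)} \<Longrightarrow> 0 < x i" and "X \<subset> Y" and "0 \<in> X"
  shows "subspace_weight x X < subspace_weight x Y"
proof -
  obtain v where v: "v \<in> Y" "v \<notin> X" using assms(2) by blast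
  then have "v \<noteq> 0" using assms(3) by auto
  show ?thesis
    unfolding subspace_weight_def
  proof (rule sum_strict_mono2)
    show "v \<in> (Y - {0}) - (X - {0})" using v \<open>v \<noteq> 0\<close> by blast
    show "0 < vector_weight x v" using vector_weight_pos[OF x \<open>v \<noteq> 0\<close>] .
    show "0 \<le> vector_weight x w" if "w \<in> Y - {0}" for w
      using vector_weight_pos[of x w] x that by (simp add: less_imp_le)
  qed (use assms(2) in auto)
qed

text \<open>Since the eigenvalue grows strictly with the span of the word, the factors can be
  consumed in increasing order.\<close>

lemma shift_op_prod_word_eq_0:
  fixes h :: "('a::{field,finite} ^ 'n) set list \<Rightarrow> real"
  assumes x: "\<And>i. i \<in> {1..CARD('n)} \<Longrightarrow> 0 < x i"
    and "sorted rs" and "0 \<notin> set P"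
    and "\<And>Y. vec.subspace Y \<Longrightarrow> set P \<subseteq> Y \<Longrightarrow> subspace_weight x Y \<in> set rs"
    and F: "F \<in> complete_flags"
  shows "shift_op_prod x rs (\<lambda>F. h (word_act P F)) F = 0"
  using assms(2-4)
proof (induction rs arbitrary: P)
  case Nil
  \<comment> \<open>The weight of the whole space would have to occur in the empty list.\<close>
  from Nil.prems(3)[OF vec.subspace_UNIV] show ?case by simp
next
  case (Cons r rs)
  let ?U = "vec.span (set P)"
  let ?S = "shift_op_prod x rs (\<lambda>F. h (word_act P F)) F"
  have PU: "set P \<subseteq> ?U" by (rule vec.span_superset)
  have weight: "subspace_weight x Y = subspace_weight x ?U \<or> subspace_weight x ?U < subspace_weight x Y"
    if "vec.subspace Y" "set P \<subseteq> Y" for Y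
  proof (cases "Y = ?U")
    case False
    then have "?U \<subset> Y" using vec.span_minimal[OF that(2,1)] by blast
    then show ?thesis using subspace_weight_strict_mono[of x ?U Y, OF x] vec.span_zero by blast
  qed simp
  have r: "r \<le> subspace_weight x ?U"
    using Cons.prems(1) Cons.prems(3)[OF vec.subspace_span PU] by auto
  \<comment> \<open>A letter outside the span raises the weight of every superspace of the word
    above \<open>r\<close>, so the remaining roots still suffice.\<close>
  have out: "shift_op_prod x rs (\<lambda>F. h (word_act (P @ [v]) F)) F = 0" if v: "v \<notin> ?U" for v
  proof (rule Cons.IH)
    have "v \<noteq> 0" using v vec.span_zero by metis
    then show "0 \<notin> set (P @ [v])" using Cons.prems(2) by simp
    fix Y assume Y: "vec.subspace Y" "set (P @ [v]) \<subseteq> Y"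
    then have "?U \<subset> Y" using vec.span_minimal[of "set P" Y] v by auto
    then have "r < subspace_weight x Y"
      using subspace_weight_strict_mono[of x ?U Y, OF x] vec.span_zero r by fastforce
    then show "subspace_weight x Y \<in> set rs" using Cons.prems(3)[OF Y(1)] Y(2) by auto
  qed (use Cons.prems in simp)
  \<comment> \<open>A letter inside the span is absorbed, so these terms combine to the weight of
    the span times \<open>?S\<close>.\<close>
  have inside: "shift_op_prod x rs (\<lambda>F. h (word_act (P @ [v]) F)) F = ?S" if "v \<in> ?U - {0}" for v
    using that Cons.prems(2) F
    by (intro shift_op_prod_cong) (auto simp: word_act_snoc word_act_absorb)
  have "(\<Sum>v\<in>UNIV - {0}. vector_weight x v * shift_op_prod x rs (\<lambda>F. h (word_act (P @ [v]) F)) F)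
      = (\<Sum>v\<in>?U - {0}. vector_weight x v * shift_op_prod x rs (\<lambda>F. h (word_act (P @ [v]) F)) F)"
    using out by (intro sum.mono_neutral_right) auto
  also have "\<dots> = (\<Sum>v\<in>?U - {0}. vector_weight x v * ?S)"
    using inside by (intro sum.cong refl) simp
  also have "\<dots> = subspace_weight x ?U * ?S"
    by (simp add: subspace_weight_def sum_distrib_right)
  finally have eq: "shift_op_prod x (r # rs) (\<lambda>F. h (word_act P F)) F = (subspace_weight x ?U - r) * ?S"
    by (simp only: shift_op_prod_Cons_word left_diff_distrib)
  show ?case
  \<comment> \<open>Either the factor vanishes, or \<open>r\<close> lies below the weight of every
    superspace, and dropping it loses no root.\<close>
  proof (cases "r = subspace_weight x ?U")
    case False
    have "?S = 0"
    proof (rule Cons.IH)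
      fix Y assume Y: "vec.subspace Y" "set P \<subseteq> Y"
      then show "subspace_weight x Y \<in> set rs" using Cons.prems(3)[OF Y] weight[OF Y] r False by auto
    qed (use Cons.prems in simp_all)
    then show ?thesis using eq by simp
  qed (use eq in simp)
qed

text \<open>Without factors the left side counts the flags fixed by the word, which the sum of
  \<open>q\<close>-derangement numbers expresses. For each further factor, exchanging the sums over
  \<open>v\<close> and over the subspaces \<open>Y\<close> containing \<open>v\<close> produces the
  weight of \<open>Y\<close>. The empty word gives the trace of the operator polynomial; the other
  words serve the induction.\<close>

lemma trace_shift_op_prod_word:
  fixes P :: "('a::{field,finite} ^ 'n) list"
  assumes "0 \<notin> set P"
  shows "(\<Sum>G\<in>complete_flags. shift_op_prod x rs (\<lambda>F. of_bool (word_act P F = G)) G)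
    = (\<Sum>Y | vec.subspace Y \<and> set P \<subseteq> Y. q_derangements (real CARD('a)) (CARD('n) - vec.dim Y)
        * (\<Prod>r\<leftarrow>rs. subspace_weight x Y - r))"
  using assms
proof (induction rs arbitrary: P)
  case Nil
  let ?U = "vec.span (set P)"
  have "(\<Sum>G\<in>complete_flags. of_bool (word_act P G = G)) = real (card {F \<in> complete_flags. word_act P F = F})"
  proof -
    have "(\<Sum>G\<in>complete_flags. of_bool (word_act P G = G) :: real) = (\<Sum>G\<in>{F \<in> complete_flags. word_act P F = F}. 1)"
      using finite_complete_flags by (intro sum.mono_neutral_cong_right) auto
    then show ?thesis by simp
  qed
  also have "\<dots> = q_fact (real CARD('a)) (CARD('n) - vec.dim ?U)"
    by (rule card_fixed_flags[OF Nil])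
  also have "\<dots> = (\<Sum>Y | vec.subspace Y \<and> ?U \<subseteq> Y. q_derangements (real CARD('a)) (CARD('n) - vec.dim Y))"
    by (rule sum_q_derangements_superspaces[OF vec.subspace_span, symmetric])
  also have "{Y. vec.subspace Y \<and> ?U \<subseteq> Y} = {Y. vec.subspace Y \<and> set P \<subseteq> Y}"
    using vec.span_minimal vec.span_superset by blast
  finally show ?case by simp
next
  case (Cons r rs)
  let ?D = "\<lambda>Y. q_derangements (real CARD('a)) (CARD('n) - vec.dim Y) * (\<Prod>r\<leftarrow>rs. subspace_weight x Y - r)"
  let ?Ys = "{Y. vec.subspace Y \<and> set P \<subseteq> Y}"
  have "(\<Sum>G\<in>complete_flags. shift_op_prod x (r # rs) (\<lambda>F. of_bool (word_act P F = G)) G)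
    = (\<Sum>G\<in>complete_flags. (\<Sum>v\<in>UNIV - {0}. vector_weight x v *
          shift_op_prod x rs (\<lambda>F. of_bool (word_act (P @ [v]) F = G)) G)
        - r * shift_op_prod x rs (\<lambda>F. of_bool (word_act P F = G)) G)"
    by (intro sum.cong refl shift_op_prod_Cons_word[where h = "\<lambda>H. of_bool (H = _)"])
  also have "\<dots> = (\<Sum>v\<in>UNIV - {0}. vector_weight x v *
          (\<Sum>G\<in>complete_flags. shift_op_prod x rs (\<lambda>F. of_bool (word_act (P @ [v]) F = G)) G))
        - r * (\<Sum>G\<in>complete_flags. shift_op_prod x rs (\<lambda>F. of_bool (word_act P F = G)) G)"
    unfolding sum_subtractf sum_distrib_left by (subst sum.swap) (rule refl)
  also have "(\<Sum>G\<in>complete_flags. shift_op_prod x rs (\<lambda>F. of_bool (word_act P F = G)) G) = (\<Sum>Y\<in>?Ys. ?D Y)"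
    by (rule Cons.IH[OF Cons.prems])
  also have "(\<Sum>v\<in>UNIV - {0}. vector_weight x v *
          (\<Sum>G\<in>complete_flags. shift_op_prod x rs (\<lambda>F. of_bool (word_act (P @ [v]) F = G)) G))
      = (\<Sum>v\<in>UNIV - {0}. \<Sum>Y | Y \<in> ?Ys \<and> v \<in> Y. vector_weight x v * ?D Y)"
  proof (intro sum.cong refl)
    fix v :: "'a ^ 'n" assume "v \<in> UNIV - {0}"
    then have "0 \<notin> set (P @ [v])" using Cons.prems by simp
    from Cons.IH[OF this] have "(\<Sum>G\<in>complete_flags. shift_op_prod x rs (\<lambda>F. of_bool (word_act (P @ [v]) F = G)) G)
      = (\<Sum>Y | vec.subspace Y \<and> set (P @ [v]) \<subseteq> Y. ?D Y)" .
    also have "{Y. vec.subspace Y \<and> set (P @ [v]) \<subseteq> Y} = {Y. Y \<in> ?Ys \<and> v \<in> Y}" by auto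
    finally show "vector_weight x v * (\<Sum>G\<in>complete_flags. shift_op_prod x rs (\<lambda>F. of_bool (word_act (P @ [v]) F = G)) G)
      = (\<Sum>Y | Y \<in> ?Ys \<and> v \<in> Y. vector_weight x v * ?D Y)"
      by (simp only: sum_distrib_left)
  qed
  also have "\<dots> = (\<Sum>Y\<in>?Ys. \<Sum>v | v \<in> UNIV - {0} \<and> v \<in> Y. vector_weight x v * ?D Y)"
    by (rule sum.swap_restrict) (rule finite)+
  also have "\<dots> = (\<Sum>Y\<in>?Ys. subspace_weight x Y * ?D Y)"
  proof (intro sum.cong refl)
    fix Y :: "('a ^ 'n) set"
    have "{v. v \<in> UNIV - {0} \<and> v \<in> Y} = Y - {0}" by auto
    then show "(\<Sum>v | v \<in> UNIV - {0} \<and> v \<in> Y. vector_weight x v * ?D Y) = subspace_weight x Y * ?D Y"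
      by (simp only: subspace_weight_def sum_distrib_right)
  qed
  also have "\<dots> - r * (\<Sum>Y\<in>?Ys. ?D Y) = (\<Sum>Y\<in>?Ys. subspace_weight x Y * ?D Y - r * ?D Y)"
    by (simp only: sum_distrib_left sum_subtractf)
  also have "\<dots> = (\<Sum>Y\<in>?Ys. q_derangements (real CARD('a)) (CARD('n) - vec.dim Y)
      * (\<Prod>r\<leftarrow>r # rs. subspace_weight x Y - r))"
    by (intro sum.cong refl) (simp add: algebra_simps)
  finally show ?case .
qed

section \<open>From functions to the transition matrix\<close>

definition flag_vec :: "('a ^ 'n) set list list \<Rightarrow> (('a::{field,finite} ^ 'n) set list \<Rightarrow> real) \<Rightarrow> real Matrix.vec" where
  "flag_vec fs f = Matrix.vec (length fs) (\<lambda>i. f (fs ! i))"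

lemma sum_nth_eq_sum_set:
  fixes g :: "'b \<Rightarrow> 'c::comm_monoid_add"
  shows "distinct fs \<Longrightarrow> (\<Sum>j<length fs. g (fs ! j)) = (\<Sum>G\<in>set fs. g G)"
  using bij_betw_nth[of fs "{..<length fs}" "set fs"] by (intro sum.reindex_bij_betw) simp

context
  fixes fs :: "('a::{field,finite} ^ 'n) set list list" and x :: "nat \<Rightarrow> real"
  assumes fs: "distinct fs" "set fs = complete_flags"
begin

lemma tsetlin_matrix_carrier: "tsetlin_matrix b x fs \<in> carrier_mat (length fs) (length fs)"
  by (simp add: tsetlin_matrix_def)

lemma tsetlin_matrix_mult_flag_vec:
  "tsetlin_matrix b x fs *\<^sub>v flag_vec fs f = flag_vec fs (tsetlin_op x f)"
proof (rule eq_vecI)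
  fix i assume "i < dim_vec (flag_vec fs (tsetlin_op x f))"
  then have i: "i < length fs" by (simp add: flag_vec_def)
  then have Fi: "fs ! i \<in> complete_flags" using fs(2) nth_mem by blast
  let ?w = "\<lambda>v G. vector_weight x v * of_bool (flag_insert (fs ! i) (vec.span {v}) = G)"
  have "(tsetlin_matrix b x fs *\<^sub>v flag_vec fs f) $ i
    = (\<Sum>j<length fs. tsetlin_coeff b x (fs ! i) (fs ! j) * f (fs ! j))"
    using i by (simp add: tsetlin_matrix_def flag_vec_def scalar_prod_def lessThan_atLeast0)
  also have "\<dots> = (\<Sum>G\<in>complete_flags. tsetlin_coeff b x (fs ! i) G * f G)"
    using sum_nth_eq_sum_set[OF fs(1), of "\<lambda>G. tsetlin_coeff b x (fs ! i) G * f G"] fs(2) by simp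
  also have "\<dots> = (\<Sum>v\<in>UNIV - {0}. \<Sum>G\<in>complete_flags. ?w v G * f G)"
    unfolding tsetlin_coeff_eq sum_distrib_right by (rule sum.swap)
  also have "\<dots> = (\<Sum>v\<in>UNIV - {0}. vector_weight x v * f (flag_insert (fs ! i) (vec.span {v})))"
  proof (intro sum.cong refl)
    fix v :: "'a ^ 'n" assume "v \<in> UNIV - {0}"
    then have "flag_insert (fs ! i) (vec.span {v}) \<in> complete_flags"
      using Fi by (auto intro: flag_insert_complete)
    then have "(\<Sum>G\<in>complete_flags. ?w v G * f G) = (\<Sum>G\<in>{flag_insert (fs ! i) (vec.span {v})}. ?w v G * f G)"
      using finite_complete_flags by (intro sum.mono_neutral_right) auto
    then show "(\<Sum>G\<in>complete_flags. ?w v G * f G) = vector_weight x v * f (flag_insert (fs ! i) (vec.span {v}))"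
      by simp
  qed
  finally show "(tsetlin_matrix b x fs *\<^sub>v flag_vec fs f) $ i = flag_vec fs (tsetlin_op x f) $ i"
    using i by (simp add: flag_vec_def tsetlin_op_def)
qed (simp add: flag_vec_def tsetlin_matrix_def)

lemma shift_prod_mult_flag_vec:
  "shift_prod (tsetlin_matrix b x fs) rs *\<^sub>v flag_vec fs f = flag_vec fs (shift_op_prod x rs f)"
proof (induction rs arbitrary: f)
  case Nil
  then show ?case by (simp add: flag_vec_def tsetlin_matrix_def)
next
  case (Cons r rs)
  have "flag_vec fs f \<in> carrier_vec (length fs)" by (simp add: flag_vec_def)
  note shift_prod_Cons_vec[OF tsetlin_matrix_carrier this, of r rs]
  also have "tsetlin_matrix b x fs *\<^sub>v flag_vec fs f - r \<cdot>\<^sub>v flag_vec fs f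
    = flag_vec fs (\<lambda>F. tsetlin_op x f F - r * f F)"
    unfolding tsetlin_matrix_mult_flag_vec by (intro eq_vecI) (auto simp: flag_vec_def)
  finally show ?case using Cons.IH by simp
qed

text \<open>Column \<open>j\<close> is the image of the indicator of \<open>fs ! j\<close>. The
  empty word is inserted so that the results on words apply.\<close>

lemma shift_prod_index:
  assumes "i < length fs" "j < length fs"
  shows "shift_prod (tsetlin_matrix b x fs) rs $$ (i, j)
    = shift_op_prod x rs (\<lambda>F. of_bool (word_act [] F = fs ! j)) (fs ! i)"
proof -
  let ?R = "shift_prod (tsetlin_matrix b x fs) rs"
  note R = shift_prod_carrier[OF tsetlin_matrix_carrier, of rs]
  have "flag_vec fs (\<lambda>F. of_bool (word_act [] F = fs ! j)) = unit_vec (length fs) j"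
    using assms fs(1) by (intro eq_vecI) (auto simp: flag_vec_def nth_eq_iff_index_eq)
  then have "col ?R j = flag_vec fs (shift_op_prod x rs (\<lambda>F. of_bool (word_act [] F = fs ! j)))"
    using shift_prod_mult_flag_vec[of rs "\<lambda>F. of_bool (word_act [] F = fs ! j)"]
      mat_mult_unit_vec[OF R assms(2)] by simp
  from arg_cong[OF this, of "\<lambda>v. v $ i"] show ?thesis
    using assms R by (simp add: flag_vec_def carrier_matD[OF R])
qed

text \<open>Both the weight and the dimension of a subspace depend only on its pivots, so the sum
  over subspaces collapses to a sum over cells, each counted with its size.\<close>

lemma trace_shift_prod_tsetlin:
  "(\<Sum>i<length fs. shift_prod (tsetlin_matrix b x fs) rs $$ (i, i))
    = (\<Sum>S\<in>Pow {1..CARD('n)}.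
        real (q_derangement_number CARD('a) (CARD('n) - card S) * CARD('a) ^ cell_dim S)
        * (\<Prod>r\<leftarrow>rs. tsetlin_eigenvalue (real CARD('a)) CARD('n) x S - r))"
proof -
  let ?D = "\<lambda>Y :: ('a ^ 'n) set. q_derangements (real CARD('a)) (CARD('n) - vec.dim Y)
      * (\<Prod>r\<leftarrow>rs. subspace_weight x Y - r)"
  have "(\<Sum>i<length fs. shift_prod (tsetlin_matrix b x fs) rs $$ (i, i))
    = (\<Sum>i<length fs. shift_op_prod x rs (\<lambda>F. of_bool (word_act [] F = fs ! i)) (fs ! i))"
    by (intro sum.cong refl shift_prod_index) simp_all
  also have "\<dots> = (\<Sum>G\<in>(complete_flags :: ('a ^ 'n) set list set). shift_op_prod x rs (\<lambda>F. of_bool (word_act [] F = G)) G)"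
    using sum_nth_eq_sum_set[OF fs(1), of "\<lambda>G. shift_op_prod x rs (\<lambda>F. of_bool (word_act [] F = G)) G"] fs(2)
    by simp
  also have "\<dots> = (\<Sum>Y | vec.subspace Y \<and> set [] \<subseteq> Y. ?D Y)"
    by (rule trace_shift_op_prod_word) simp
  also have "\<dots> = (\<Sum>S\<in>Pow {1..CARD('n)}. \<Sum>Y | Y \<in> {Y. vec.subspace Y \<and> set [] \<subseteq> Y} \<and> pivots Y = S. ?D Y)"
    using pivots_subset by (intro sum.group[symmetric]) auto
  also have "\<dots> = (\<Sum>S\<in>Pow {1..CARD('n)}.
        real (q_derangement_number CARD('a) (CARD('n) - card S) * CARD('a) ^ cell_dim S)
        * (\<Prod>r\<leftarrow>rs. tsetlin_eigenvalue (real CARD('a)) CARD('n) x S - r))"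
  proof (intro sum.cong refl)
    fix S assume "S \<in> Pow {1..CARD('n)}"
    then have S: "S \<subseteq> {1..CARD('n)}" "finite S" using finite_subset by auto
    have "(\<Sum>Y | Y \<in> {Y. vec.subspace Y \<and> set [] \<subseteq> Y} \<and> pivots Y = S. ?D Y) = (\<Sum>Y\<in>pivot_cell S. ?D Y)"
      by (intro sum.cong) (auto simp: pivot_cell_def)
    also have "\<dots> = (\<Sum>Y\<in>(pivot_cell S :: ('a ^ 'n) set set). real (q_derangement_number CARD('a) (CARD('n) - card S))
        * (\<Prod>r\<leftarrow>rs. tsetlin_eigenvalue (real CARD('a)) CARD('n) x S - r))"
    proof (intro sum.cong refl)
      fix Y :: "('a ^ 'n) set" assume Y: "Y \<in> pivot_cell S"
      then have "card Y = CARD('a) ^ card S" using S by (auto simp: pivot_cell_def intro!: card_if_pivots)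
      then have "vec.dim Y = card S" using Y dim_eq_if_card_eq[of Y] by (simp add: pivot_cell_def)
      then show "?D Y = real (q_derangement_number CARD('a) (CARD('n) - card S))
        * (\<Prod>r\<leftarrow>rs. tsetlin_eigenvalue (real CARD('a)) CARD('n) x S - r)"
        using subspace_weight_eq_eigenvalue[OF S(2,1) Y, of x] q_derangements_eq_nat[of "CARD('a)"] by simp
    qed
    also have "\<dots> = real (q_derangement_number CARD('a) (CARD('n) - card S) * CARD('a) ^ cell_dim S)
        * (\<Prod>r\<leftarrow>rs. tsetlin_eigenvalue (real CARD('a)) CARD('n) x S - r)"
      by (simp add: card_pivot_cell[OF S(2,1)])
    finally show "(\<Sum>Y | Y \<in> {Y. vec.subspace Y \<and> set [] \<subseteq> Y} \<and> pivots Y = S. ?D Y)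
      = real (q_derangement_number CARD('a) (CARD('n) - card S) * CARD('a) ^ cell_dim S)
        * (\<Prod>r\<leftarrow>rs. tsetlin_eigenvalue (real CARD('a)) CARD('n) x S - r)" .
  qed
  finally show ?thesis .
qed

lemma shift_prod_tsetlin_eq_0:
  assumes x: "\<And>i. i \<in> {1..CARD('n)} \<Longrightarrow> 0 < x i"
  shows "\<exists>rs. distinct rs \<and> shift_prod (tsetlin_matrix b x fs) rs = 0\<^sub>m (length fs) (length fs)"
proof (intro exI conjI)
  \<comment> \<open>All weights of subspaces, each once: distinctness is what diagonalizability
    requires, and increasing order what the annihilation requires.\<close>
  let ?rs = "sorted_list_of_set (subspace_weight x ` {Y :: ('a ^ 'n) set. vec.subspace Y})"
  note R = shift_prod_carrier[OF tsetlin_matrix_carrier, of ?rs]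
  show "distinct ?rs" by simp
  show "shift_prod (tsetlin_matrix b x fs) ?rs = 0\<^sub>m (length fs) (length fs)"
  proof (rule eq_matI)
    fix i j assume "i < dim_row (0\<^sub>m (length fs) (length fs) :: real mat)" "j < dim_col (0\<^sub>m (length fs) (length fs) :: real mat)"
    then have ij: "i < length fs" "j < length fs" by simp_all
    then have Fi: "fs ! i \<in> complete_flags" using fs(2) nth_mem by blast
    have "shift_op_prod x ?rs (\<lambda>F. of_bool (word_act [] F = fs ! j)) (fs ! i) = 0"
      by (rule shift_op_prod_word_eq_0[where h = "\<lambda>H. of_bool (H = fs ! j)", OF x _ _ _ Fi]) auto
    then show "shift_prod (tsetlin_matrix b x fs) ?rs $$ (i, j) = 0\<^sub>m (length fs) (length fs) $$ (i, j)"
      using shift_prod_index[OF ij] ij by simp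
  qed (use carrier_matD[OF R] in simp_all)
qed

end

text \<open>Only the whole space has all indices as pivots, so this cell is a single point. It
  settles the separate case m([n]) = 1.\<close>

lemma pivot_multiplicity_full:
  "CARD('a::{field,finite}) ^ cell_dim {1..CARD('n)} = 1"
proof -
  have "pivot_cell {1..CARD('n)} \<subseteq> {UNIV :: ('a ^ 'n) set}"
  proof
    fix Y :: "('a ^ 'n) set" assume "Y \<in> pivot_cell {1..CARD('n)}"
    then have "card Y = CARD('a) ^ card {1..CARD('n)}"
      unfolding pivot_cell_def by (intro card_if_pivots) blast+
    then have "card Y = CARD('a ^ 'n)" by simp
    then show "Y \<in> {UNIV}" using card_subset_eq[of UNIV Y] by simp
  qed
  then have "card (pivot_cell {1..CARD('n)} :: ('a ^ 'n) set set) \<le> 1"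
    using card_mono[of "{UNIV :: ('a ^ 'n) set}"] by fastforce
  moreover have "CARD('a) ^ cell_dim {1..CARD('n)} \<noteq> 0" by simp
  ultimately show ?thesis
    using card_pivot_cell[OF finite_atLeastAtMost subset_refl, where 'a='a] by linarith
qed

end

text \<open>The products that omit a single value isolate its multiplicity on both sides.\<close>

lemma prod_linear_factors_eqI:
  fixes d :: "nat \<Rightarrow> real" and l :: "'b \<Rightarrow> real" and a :: "'b \<Rightarrow> nat"
  assumes A: "finite A"
    and eq: "\<And>rs. (\<Sum>i<N. \<Prod>r\<leftarrow>rs. d i - r) = (\<Sum>y\<in>A. real (a y) * (\<Prod>r\<leftarrow>rs. l y - r))"
  shows "(\<Prod>i<N. [:- d i, 1:]) = (\<Prod>y\<in>A. [:- l y, 1:] ^ a y)"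
proof -
  let ?V = "d ` {..<N} \<union> l ` A"
  have V: "finite ?V" using A by simp
  have count: "card {i \<in> {..<N}. d i = \<mu>} = (\<Sum>y | y \<in> A \<and> l y = \<mu>. a y)" for \<mu>
  proof -
    let ?rs = "sorted_list_of_set (?V - {\<mu>})"
    define c where "c = (\<Prod>r\<leftarrow>?rs. \<mu> - r)"
    have c: "c \<noteq> 0" unfolding c_def using V by (auto simp: prod_list_zero_iff)
    have p: "(\<Prod>r\<leftarrow>?rs. t - r) = (if t = \<mu> then c else 0)" if "t \<in> ?V" for t
      using that V by (auto simp: c_def prod_list_zero_iff)
    have "real (card {i \<in> {..<N}. d i = \<mu>}) * c = (\<Sum>i | i \<in> {..<N} \<and> d i = \<mu>. c)" by simp
    also have "\<dots> = (\<Sum>i<N. \<Prod>r\<leftarrow>?rs. d i - r)"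
      by (rule sum.mono_neutral_cong_left) (auto simp: p c_def)
    also have "\<dots> = (\<Sum>y\<in>A. real (a y) * (\<Prod>r\<leftarrow>?rs. l y - r))" by (rule eq)
    also have "\<dots> = (\<Sum>y | y \<in> A \<and> l y = \<mu>. real (a y) * c)"
      by (rule sum.mono_neutral_cong_right) (use A in \<open>auto simp: p c_def\<close>)
    also have "\<dots> = real (\<Sum>y | y \<in> A \<and> l y = \<mu>. a y) * c" by (simp add: sum_distrib_right)
    finally have "real (card {i \<in> {..<N}. d i = \<mu>}) = real (\<Sum>y | y \<in> A \<and> l y = \<mu>. a y)"
      using c by (metis mult_right_cancel)
    then show ?thesis by (simp only: of_nat_eq_iff)
  qed
  \<comment> \<open>The factors are grouped by root; equal counts for each root then match the
    powers.\<close>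
  have "(\<Prod>i<N. [:- d i, 1:]) = (\<Prod>\<mu>\<in>?V. \<Prod>i | i \<in> {..<N} \<and> d i = \<mu>. [:- d i, 1:])"
    using V by (intro prod.group[symmetric]) auto
  also have "\<dots> = (\<Prod>\<mu>\<in>?V. [:- \<mu>, 1:] ^ card {i \<in> {..<N}. d i = \<mu>})"
    by (intro prod.cong refl) simp
  also have "\<dots> = (\<Prod>\<mu>\<in>?V. \<Prod>y | y \<in> A \<and> l y = \<mu>. [:- l y, 1:] ^ a y)"
    unfolding count power_sum by (intro prod.cong refl) simp
  also have "\<dots> = (\<Prod>y\<in>A. [:- l y, 1:] ^ a y)"
    using V A by (intro prod.group) auto
  finally show ?thesis .
qed

section \<open>The characteristic polynomial\<close>

lemma char_poly_diagonal_mat: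
  fixes D :: "'a::comm_ring_1 mat"
  assumes "D \<in> carrier_mat n n" "diagonal_mat D"
  shows "char_poly D = (\<Prod>i<n. [:- D $$ (i, i), 1:])"
proof -
  have "upper_triangular D" using assms by (auto simp: upper_triangular_def diagonal_mat_def)
  then have "char_poly D = (\<Prod>a\<leftarrow>diag_mat D. [:- a, 1:])"
    by (rule char_poly_upper_triangular[OF assms(1)])
  also have "\<dots> = (\<Prod>i\<leftarrow>[0..<n]. [:- D $$ (i, i), 1:])"
    using assms(1) by (simp add: diag_mat_def comp_def)
  also have "\<dots> = (\<Prod>i<n. [:- D $$ (i, i), 1:])"
    by (simp add: prod.distinct_set_conv_list lessThan_atLeast0 flip: set_upt)
  finally show ?thesis .
qed

theorem theorem2p22:
  fixes b :: "nat \<Rightarrow> 'n::finite"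
    and fs :: "('a::{field,finite} ^ 'n) set list list"
    and x :: "nat \<Rightarrow> real"
    and n q :: nat
  assumes "n = CARD('n)" and "q = CARD('a)"
    and "bij_betw b {1..n} (UNIV :: 'n set)"
    and "\<And>i. i \<in> {1..n} \<Longrightarrow> 0 < x i"
    and "(\<Sum>i=1..n. x i) = 1"
    and "distinct fs" and "set fs = complete_flags"
  shows "\<exists>m :: nat set \<Rightarrow> nat.
      (\<forall>S. S \<subseteq> {1..n} \<longrightarrow> real (m S) = tsetlin_mult q n S)
    \<and> char_poly (tsetlin_matrix b x fs)
        = (\<Prod>S\<in>Pow {1..n}. [:- tsetlin_eigenvalue q n x S, 1:] ^ m S)
    \<and> (\<forall>\<mu>. eigenvalue (tsetlin_matrix b x fs) \<mu>
          \<longleftrightarrow> (\<exists>S. S \<subseteq> {1..n} \<and> m S \<noteq> 0 \<and> \<mu> = tsetlin_eigenvalue q n x S))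
    \<and> diagonalizable_mat (tsetlin_matrix b x fs)"
proof -
  interpret ordered_basis b by unfold_locales (use assms in simp)
  define m where "m S = q_derangement_number q (n - card S) * q ^ cell_dim S" for S
  let ?M = "tsetlin_matrix b x fs" and ?l = "tsetlin_eigenvalue (real q) n x"
  note M = tsetlin_matrix_carrier[OF assms(6,7), of x]
  have x: "\<And>i. i \<in> {1..CARD('n)} \<Longrightarrow> 0 < x i" using assms(1,4) by simp
  have q: "0 < q" using assms(2) by simp
  have mult: "real (m S) = tsetlin_mult q n S" if S: "S \<subseteq> {1..n}" for S
  proof (cases "card S = n")
    case True
    then have "S = {1..n}" using S card_subset_eq[of "{1..n}" S] by simp
    then have "q ^ cell_dim S = 1" using pivot_multiplicity_full[where 'a='a] assms(1,2) by (simp only:)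
    then have "m S = 1" unfolding m_def using True by (simp only: diff_self_eq_0 q_derangement_number.simps)
    then show ?thesis using True by (simp add: tsetlin_mult_def)
  next
    case False
    then show ?thesis
      by (simp add: m_def tsetlin_mult_def q_derangements_eq_nat[OF q] cell_dim_def assms(1))
  qed
  obtain rs where "distinct rs" "shift_prod ?M rs = 0\<^sub>m (length fs) (length fs)"
    using shift_prod_tsetlin_eq_0[OF assms(6,7), of x] x by blast
  then obtain D where D: "D \<in> carrier_mat (length fs) (length fs)" "diagonal_mat D" "similar_mat ?M D"
    using similar_diagonal_if_shift_prod_zero[OF M] by blast
  \<comment> \<open>The trace of every product of shifts is computed twice, from the diagonal form
    and from the pivot cells.\<close>
  have "(\<Sum>i<length fs. \<Prod>r\<leftarrow>rs. D $$ (i, i) - r) = (\<Sum>S\<in>Pow {1..n}. real (m S) * (\<Prod>r\<leftarrow>rs. ?l S - r))" for rs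
    using trace_shift_prod[OF M D, of rs] trace_shift_prod_tsetlin[OF assms(6,7), of x rs]
    unfolding m_def assms(1,2) by (simp only:)
  then have "(\<Prod>i<length fs. [:- D $$ (i, i), 1:]) = (\<Prod>S\<in>Pow {1..n}. [:- ?l S, 1:] ^ m S)"
    by (intro prod_linear_factors_eqI) simp_all
  then have char: "char_poly ?M = (\<Prod>S\<in>Pow {1..n}. [:- ?l S, 1:] ^ m S)"
    using char_poly_similar[OF D(3)] char_poly_diagonal_mat[OF D(1,2)] by simp
  \<comment> \<open>A product of powers vanishes at a point exactly if some base with nonzero
    exponent does, which leaves the sets with \<open>m S\<close> nonzero.\<close>
  have "eigenvalue ?M \<mu> \<longleftrightarrow> (\<exists>S. S \<subseteq> {1..n} \<and> m S \<noteq> 0 \<and> \<mu> = ?l S)" for \<mu>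
    unfolding eigenvalue_root_char_poly[OF M] char poly_prod
    by (auto simp: poly_power)
  then show ?thesis using mult char D by (intro exI[of _ m]) (auto simp: diagonalizable_mat_def)
qed

end
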